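(* There exist universal constants $c_0,c_1,d_1,c_2,d_2>0$ such that the following holds. Let $(\psi_j)_{j\in\Lambda}$ be an orthonormal system with $|\Lambda|=N$ finite on a domain $\mathcal D$ with orthogonalization measure $\nu$, and consider weights $\omega_j\ge\|\psi_j\|_\infty$. For $s\ge2\max_j|\omega_j|^2$ and $\gamma\in(0,1)$, fix a number of samples $$m\ge c_0\, s\,\max\{\log^3(s)\log(N),\ \log(1/\gamma)\}.$$ Suppose that $t_1,\dots,t_m$ are drawn independently from $\nu$, and let $A\in\mathbb C^{m\times N}$ be the sampling matrix with entries $A_{\ell,k}=\psi_k(t_\ell)$. Then with probability exceeding $1-\gamma$, the following holds for all functions $f=\sum_{j\in\Lambda}x_j\psi_j$. Given noisy samples $y_\ell=f(t_\ell)+\xi_\ell$, $\ell=1,\dots,m$, with $\|\xi\|_2\le\eta$, let $x^\sharp$ be the solution of $$\min\|z\|_{\omega,1}\quad\text{subject to}\quad\|Az-y\|_2\le\eta$$ and set $f^\sharp=\sum_{j\in\Lambda}x_j^\sharp\psi_j$. Then $$\|f-f^\sharp\|_{L_\infty}\le|\!|\!|f-f^\sharp|\!|\!|_{\omega,1}\le c_1\,\sigma_s(f)_{\omega,1}+d_1\,\eta\sqrt{\frac sm},$$ $$\|f-f^\sharp\|_{L_2}\le c_2\,\frac{\sigma_s(f)_{\omega,1}}{\sqrt s}+d_2\,\eta\sqrt{\frac1m}.$$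
   Context: Functions $\psi_j:\mathcal D\to\mathbb C$, $j\in\Lambda$, on a bounded domain $\mathcal D$ form an orthonormal system with orthogonalization measure $\nu$ if $\nu$ is a probability measure on $\mathcal D$ and $\int_{\mathcal D}\psi_j\overline{\psi_k}\,d\nu=\delta_{j,k}$ for all $j,k\in\Lambda$. Here $\|\psi_j\|_\infty$ and $\|\cdot\|_{L_\infty}$ denote the sup norm on $\mathcal D$ and $\|\cdot\|_{L_2}$ is the norm of $L_2(\mathcal D,\nu)$. Weights always satisfy $\omega_j\ge 1$. For $x=(x_j)_{j\in\Lambda}$: $\|x\|_{\omega,1}=\sum_{j}\omega_j|x_j|$ and $\|x\|_{\omega,0}=\sum_{j:x_j\ne0}\omega_j^2$. The error of best weighted $s$-term approximation is $\sigma_s(x)_{\omega,1}=\inf\{\|x-z\|_{\omega,1}:\ \|z\|_{\omega,0}\le s\}$. For $f=\sum_{j\in\Lambda}x_j\psi_j$, $|\!|\!|f|\!|\!|_{\omega,1}:=\|x\|_{\omega,1}$ and $\sigma_s(f)_{\omega,1}:=\sigma_s(x)_{\omega,1}$. *)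

theory Defs
  imports "HOL-Probability.Probability"
begin

text \<open>
  Points of \<open>R^d\<close> are the extensional functions on \<open>{..<d}\<close>, so that the dimension is an ordinary
  quantifiable number: constants quantified outermost in a statement are then independent of it.
  A domain is any bounded subset of \<open>R^d\<close>; openness and connectedness are not required, so that
  intervals \<open>[-1,1]\<close>, cubes and spheres are included.
\<close>
definition bounded_domain :: "nat \<Rightarrow> (nat \<Rightarrow> real) set \<Rightarrow> bool" where
  "bounded_domain d D \<longleftrightarrow>
     D \<subseteq> (\<Pi>\<^sub>E i\<in>{..<d}. UNIV) \<and> (\<exists>B. \<forall>x\<in>D. \<forall>i<d. \<bar>x i\<bar> \<le> B)"

text \<open>
  The sigma-algebra on \<open>D\<close> is left arbitrary. Integrability of the products is part of
  \<^const>\<open>has_bochner_integral\<close>; measurability of each \<open>\<psi> j\<close> has to be stated separately.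
\<close>
definition orthonormal_system ::
  "'a set \<Rightarrow> 'a measure \<Rightarrow> 'i set \<Rightarrow> ('i \<Rightarrow> 'a \<Rightarrow> complex) \<Rightarrow> bool" where
  "orthonormal_system D \<nu> \<Lambda> \<psi> \<longleftrightarrow>
     prob_space \<nu> \<and> space \<nu> = D \<and>
     (\<forall>j\<in>\<Lambda>. \<psi> j \<in> borel_measurable \<nu>) \<and>
     (\<forall>j\<in>\<Lambda>. \<forall>k\<in>\<Lambda>. has_bochner_integral \<nu> (\<lambda>t. \<psi> j t * cnj (\<psi> k t)) (if j = k then 1 else 0))"

text \<open>Extended-real valued, so that the norm of an unbounded function is \<open>\<infinity>\<close>.\<close>
definition sup_norm :: "'a set \<Rightarrow> ('a \<Rightarrow> complex) \<Rightarrow> ereal" where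
  "sup_norm D g = (SUP t\<in>D. ereal (cmod (g t)))"

text \<open>Only meaningful for square-integrable \<open>g\<close>, such as finite combinations of an orthonormal system.\<close>
definition L2_norm :: "'a measure \<Rightarrow> ('a \<Rightarrow> complex) \<Rightarrow> real" where
  "L2_norm \<nu> g = sqrt (\<integral>t. (cmod (g t))\<^sup>2 \<partial>\<nu>)"

text \<open>
  A vector indexed by \<open>\<Lambda>\<close> is a function on the whole index type of which only the values on \<open>\<Lambda>\<close>
  are used.
\<close>
definition weighted_l1 :: "'i set \<Rightarrow> ('i \<Rightarrow> real) \<Rightarrow> ('i \<Rightarrow> complex) \<Rightarrow> real" where
  "weighted_l1 \<Lambda> \<omega> x = (\<Sum>j\<in>\<Lambda>. \<omega> j * cmod (x j))"

definition weighted_l0 :: "'i set \<Rightarrow> ('i \<Rightarrow> real) \<Rightarrow> ('i \<Rightarrow> complex) \<Rightarrow> real" where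
  "weighted_l0 \<Lambda> \<omega> x = (\<Sum>j\<in>{j\<in>\<Lambda>. x j \<noteq> 0}. (\<omega> j)\<^sup>2)"

definition best_approx_error ::
  "'i set \<Rightarrow> ('i \<Rightarrow> real) \<Rightarrow> real \<Rightarrow> ('i \<Rightarrow> complex) \<Rightarrow> real" where
  "best_approx_error \<Lambda> \<omega> s x =
     (INF z\<in>{z. weighted_l0 \<Lambda> \<omega> z \<le> s}. weighted_l1 \<Lambda> \<omega> (\<lambda>j. x j - z j))"

definition expansion :: "'i set \<Rightarrow> ('i \<Rightarrow> 'a \<Rightarrow> complex) \<Rightarrow> ('i \<Rightarrow> complex) \<Rightarrow> 'a \<Rightarrow> complex" where
  "expansion \<Lambda> \<psi> x = (\<lambda>t. \<Sum>j\<in>\<Lambda>. x j * \<psi> j t)"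

definition sampling_matrix ::
  "('i \<Rightarrow> 'a \<Rightarrow> complex) \<Rightarrow> (nat \<Rightarrow> 'a) \<Rightarrow> nat \<Rightarrow> 'i \<Rightarrow> complex" where
  "sampling_matrix \<psi> t = (\<lambda>l k. \<psi> k (t l))"

definition mat_vec :: "'i set \<Rightarrow> (nat \<Rightarrow> 'i \<Rightarrow> complex) \<Rightarrow> ('i \<Rightarrow> complex) \<Rightarrow> nat \<Rightarrow> complex" where
  "mat_vec \<Lambda> A z = (\<lambda>l. \<Sum>k\<in>\<Lambda>. A l k * z k)"

definition l2_norm :: "nat \<Rightarrow> (nat \<Rightarrow> complex) \<Rightarrow> real" where
  "l2_norm m v = L2_set (\<lambda>l. cmod (v l)) {..<m}"

text \<open>The minimizer need not be unique; this holds of each of them.\<close>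
definition is_weighted_l1_solution ::
  "nat \<Rightarrow> 'i set \<Rightarrow> ('i \<Rightarrow> real) \<Rightarrow> (nat \<Rightarrow> 'i \<Rightarrow> complex) \<Rightarrow> (nat \<Rightarrow> complex) \<Rightarrow> real
    \<Rightarrow> ('i \<Rightarrow> complex) \<Rightarrow> bool" where
  "is_weighted_l1_solution m \<Lambda> \<omega> A y \<eta> z \<longleftrightarrow>
     is_arg_min (weighted_l1 \<Lambda> \<omega>) (\<lambda>z. l2_norm m (\<lambda>l. mat_vec \<Lambda> A z l - y l) \<le> \<eta>) z"

end

(*
  With probability exceeding 1 - \<gamma>, every v in the cone |v|_{\<omega>,1} <= 4 sqrt(s) |v|_2 satisfies
  |A v|_2 >= sqrt(m) |v|_2 / 8. This one-sided bound replaces the restricted isometry property: by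
  the usual comparison of |x#|_{\<omega>,1} with |x|_{\<omega>,1}, the error v = x - x# has
  |v|_{\<omega>,1} <= 2 sqrt(s) |v|_2 + 2 \<sigma>, so either v lies in the cone, and |A v|_2 <= 2 \<eta> bounds
  |v|_2, or |v|_2 <= \<sigma> / sqrt(s).

  For the lower bound write g for the function with coefficient vector v, |v|_2 = 1, and cut |g|^2,
  which is at most 16 s, into dyadic levels 2^i / 2 with i < n, n of order log s. At level i, Maurey's
  empirical method replaces g by a mean of about log(s) 2^(n-i) dictionary elements +-\<psi>_j / \<omega>_j,
  +-i \<psi>_j / \<omega>_j, accurately enough outside a set that is small for \<nu> and for the sample alike.
  There are finitely many such means, and a multiplicative Chernoff bound with a union bound keeps the
  empirical frequency of exceeding the level above half of its probability, unless the level carries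
  less than (1/n + 2^(i-n)) / 32 of the second moment. The term 1/n pays for the union bound, the term
  2^(i-n) makes the failure probability at every level at most exp(-c m / s) without further logarithms
  of s, and the levels that are given up carry at most a 1/16 in total.
*)
theory Submission
  imports Defs
begin

section \<open>Tail bounds\<close>

lemma exp_le_quadratic:
  fixes y :: real assumes "\<bar>y\<bar> \<le> 1" shows "exp y \<le> 1 + y + y\<^sup>2"
proof (cases "y \<ge> 0")
  case True
  then show ?thesis using exp_bound[of y] assms by simp
next
  case False
  define z where "z = - y"
  have z: "0 < z" "z \<le> 1" using False assms by (auto simp: z_def)
  have "1 + z \<le> exp z" by simp
  \<comment> \<open>The product equals \<open>1 + z ^ 3\<close>.\<close>
  moreover have "1 \<le> (1 - z + z\<^sup>2) * (1 + z)"
    using z by (simp add: algebra_simps power2_eq_square)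
  ultimately have "1 \<le> (1 - z + z\<^sup>2) * exp z"
    using z by (smt (verit) mult_left_mono zero_le_power2)
  hence "exp (- z) \<le> 1 - z + z\<^sup>2"
    by (simp add: exp_minus field_simps)
  then show ?thesis by (simp add: z_def)
qed

text \<open>Chernoff's method for i.i.d. draws from the finite law \<open>q\<close>. The expectation
  over \<open>k\<close>-tuples is spelled out as a weighted sum over \<open>PiE\<close>, so that it
  can later be interchanged with an integral over the domain and a sum over the sample.\<close>

lemma iid_sum_tail:
  fixes q X :: "'b \<Rightarrow> real"
  assumes J: "finite J" and q: "\<And>j. j \<in> J \<Longrightarrow> 0 \<le> q j" "sum q J = 1"
    and X: "\<And>j. j \<in> J \<Longrightarrow> \<bar>X j\<bar> \<le> 2" "(\<Sum>j\<in>J. q j * X j) = 0"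
    and \<rho>: "0 \<le> \<rho>" "\<rho> \<le> 8"
  shows "(\<Sum>h\<in>PiE {..<k} (\<lambda>_. J). (\<Prod>i<k. q (h i)) * of_bool (real k * (\<rho> / 2) < (\<Sum>i<k. X (h i))))
           \<le> exp (- (real k * \<rho>\<^sup>2 / 64))"
proof -
  \<comment> \<open>This minimises the exponent \<open>4 * l^2 - l * \<rho> / 2\<close>, with value
    \<open>- \<rho>^2 / 64\<close>; \<open>\<rho> <= 8\<close> keeps \<open>l * X j\<close> within
    [-1,1], where the quadratic bound on \<open>exp\<close> applies.\<close>
  define l where "l = \<rho> / 16"
  have l: "0 \<le> l" "l \<le> 1/2" using \<rho> by (auto simp: l_def)
  have mgf: "(\<Sum>j\<in>J. q j * exp (l * X j)) \<le> exp (4 * l\<^sup>2)"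
  proof -
    have "(\<Sum>j\<in>J. q j * exp (l * X j)) \<le> (\<Sum>j\<in>J. q j * (1 + l * X j + 4 * l\<^sup>2))"
    proof (intro sum_mono mult_left_mono q)
      fix j assume j: "j \<in> J"
      have "\<bar>l * X j\<bar> \<le> 1/2 * 2" unfolding abs_mult
        using l X(1)[OF j] by (intro mult_mono) auto
      hence "exp (l * X j) \<le> 1 + l * X j + (l * X j)\<^sup>2" by (intro exp_le_quadratic) simp
      moreover have "(X j)\<^sup>2 \<le> 2\<^sup>2" using X(1)[OF j] by (subst abs_le_square_iff[symmetric]) simp
      hence "(l * X j)\<^sup>2 \<le> l\<^sup>2 * 4" unfolding power_mult_distrib by (intro mult_left_mono) auto
      ultimately show "exp (l * X j) \<le> 1 + l * X j + 4 * l\<^sup>2" by simp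
    qed
    also have "\<dots> = sum q J + l * (\<Sum>j\<in>J. q j * X j) + 4 * l\<^sup>2 * sum q J"
      by (simp only: distrib_left sum.distrib sum_distrib_left sum_distrib_right mult_1_left mult_1_right mult_ac)
    also have "\<dots> = 1 + 4 * l\<^sup>2" using q X by simp
    also have "\<dots> \<le> exp (4 * l\<^sup>2)" by simp
    finally show ?thesis .
  qed
  have "(\<Sum>h\<in>PiE {..<k} (\<lambda>_. J). (\<Prod>i<k. q (h i)) * of_bool (real k * (\<rho> / 2) < (\<Sum>i<k. X (h i))))
      \<le> (\<Sum>h\<in>PiE {..<k} (\<lambda>_. J). exp (- (l * real k * (\<rho> / 2))) * (\<Prod>i<k. q (h i) * exp (l * X (h i))))"
  proof (intro sum_mono)
    fix h assume h: "h \<in> PiE {..<k} (\<lambda>_. J)"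
    have "of_bool (real k * (\<rho> / 2) < (\<Sum>i<k. X (h i))) \<le> exp (l * ((\<Sum>i<k. X (h i)) - real k * (\<rho> / 2)))"
      using l by auto
    also have "\<dots> = exp (- (l * real k * (\<rho> / 2))) * (\<Prod>i<k. exp (l * X (h i)))"
      by (simp add: exp_sum[symmetric] exp_add[symmetric] algebra_simps sum_distrib_left)
    finally have "(\<Prod>i<k. q (h i)) * of_bool (real k * (\<rho> / 2) < (\<Sum>i<k. X (h i)))
      \<le> (\<Prod>i<k. q (h i)) * (exp (- (l * real k * (\<rho> / 2))) * (\<Prod>i<k. exp (l * X (h i))))"
      using h q by (intro mult_left_mono prod_nonneg) auto
    thus "(\<Prod>i<k. q (h i)) * of_bool (real k * (\<rho> / 2) < (\<Sum>i<k. X (h i)))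
      \<le> exp (- (l * real k * (\<rho> / 2))) * (\<Prod>i<k. q (h i) * exp (l * X (h i)))"
      by (simp add: prod.distrib mult_ac)
  qed
  also have "\<dots> = exp (- (l * real k * (\<rho> / 2))) * (\<Prod>i<k. \<Sum>j\<in>J. q j * exp (l * X j))"
    by (subst prod_sum_PiE) (auto simp: J sum_distrib_left)
  also have "\<dots> \<le> exp (- (l * real k * (\<rho> / 2))) * exp (4 * l\<^sup>2) ^ k"
    using mgf q by (auto intro!: mult_left_mono power_mono sum_nonneg)
  also have "\<dots> = exp (- (real k * \<rho>\<^sup>2 / 64))"
    by (simp add: exp_of_nat_mult[symmetric] exp_add[symmetric] l_def power2_eq_square field_simps)
  finally show ?thesis .
qed

text \<open>A modulus above \<open>k * \<rho>\<close> forces one of the four signed real and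
  imaginary parts above half of that, since the modulus is at most the sum of the absolute parts.
  Each part is a centred real sum with terms bounded by 2.\<close>

lemma iid_complex_sum_tail:
  fixes q :: "'b \<Rightarrow> real" and Z :: "'b \<Rightarrow> complex"
  assumes J: "finite J" and q: "\<And>j. j \<in> J \<Longrightarrow> 0 \<le> q j" "sum q J = 1"
    and Z: "\<And>j. j \<in> J \<Longrightarrow> cmod (Z j) \<le> 1"
    and \<rho>: "0 \<le> \<rho>" "\<rho> \<le> 8"
  defines "\<mu> \<equiv> (\<Sum>j\<in>J. of_real (q j) * Z j)"
  shows "(\<Sum>h\<in>PiE {..<k} (\<lambda>_. J). (\<Prod>i<k. q (h i)) *
             of_bool (real k * \<rho> < cmod ((\<Sum>i<k. Z (h i)) - of_nat k * \<mu>)))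
           \<le> 4 * exp (- (real k * \<rho>\<^sup>2 / 64))"
proof -
  have "cmod \<mu> \<le> (\<Sum>j\<in>J. q j * cmod (Z j))"
    unfolding \<mu>_def using q by (intro order.trans[OF norm_sum] sum_mono) (auto simp: norm_mult)
  also have "\<dots> \<le> (\<Sum>j\<in>J. q j)" using q Z by (intro sum_mono) (auto intro: mult_left_le)
  finally have \<mu>1: "cmod \<mu> \<le> 1" using q by simp
  have bd: "cmod (Z j - \<mu>) \<le> 2" if "j \<in> J" for j
    using norm_triangle_ineq4[of "Z j" \<mu>] Z[OF that] \<mu>1 by linarith
  have mean: "(\<Sum>j\<in>J. of_real (q j) * (Z j - \<mu>)) = 0"
    using q(2) by (simp add: algebra_simps sum_subtractf \<mu>_def sum_distrib_right[symmetric]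
        flip: of_real_sum sum_distrib_left)
  let ?w = "\<lambda>h. \<Prod>i<k. q (h i)"
  define B where "B = (\<lambda>(X :: 'b \<Rightarrow> real) h. of_bool (real k * (\<rho> / 2) < (\<Sum>i<k. X (h i))) :: real)"
  have tail: "(\<Sum>h\<in>PiE {..<k} (\<lambda>_. J). ?w h * B X h) \<le> exp (- (real k * \<rho>\<^sup>2 / 64))"
    if "\<And>j. j \<in> J \<Longrightarrow> \<bar>X j\<bar> \<le> 2" "(\<Sum>j\<in>J. q j * X j) = 0" for X
    unfolding B_def by (rule iid_sum_tail[OF J q that \<rho>])
  define R where "R = (\<lambda>j. Re (Z j - \<mu>))"
  define M where "M = (\<lambda>j. Im (Z j - \<mu>))"
  have R: "\<bar>R j\<bar> \<le> 2" and M: "\<bar>M j\<bar> \<le> 2" if "j \<in> J" for j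
    unfolding R_def M_def using abs_Re_le_cmod[of "Z j - \<mu>"] abs_Im_le_cmod[of "Z j - \<mu>"] bd[OF that]
    by linarith+
  have R0: "(\<Sum>j\<in>J. q j * R j) = 0" and M0: "(\<Sum>j\<in>J. q j * M j) = 0"
    using arg_cong[OF mean, of Re] arg_cong[OF mean, of Im] by (simp_all add: R_def M_def)
  have "(\<Sum>h\<in>PiE {..<k} (\<lambda>_. J). ?w h *
             of_bool (real k * \<rho> < cmod ((\<Sum>i<k. Z (h i)) - of_nat k * \<mu>)))
    \<le> (\<Sum>h\<in>PiE {..<k} (\<lambda>_. J). ?w h * B R h + ?w h * B (\<lambda>j. - R j) h + ?w h * B M h + ?w h * B (\<lambda>j. - M j) h)"
  proof (intro sum_mono)
    fix h assume h: "h \<in> PiE {..<k} (\<lambda>_. J)"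
    have w: "0 \<le> ?w h" using h q by (intro prod_nonneg) auto
    have e: "(\<Sum>i<k. Z (h i)) - of_nat k * \<mu> = Complex (\<Sum>i<k. R (h i)) (\<Sum>i<k. M (h i))"
      by (simp add: complex_eq_iff R_def M_def sum_subtractf)
    have "of_bool (real k * \<rho> < cmod ((\<Sum>i<k. Z (h i)) - of_nat k * \<mu>))
       \<le> B R h + B (\<lambda>j. - R j) h + B M h + B (\<lambda>j. - M j) h"
      using cmod_le[of "(\<Sum>i<k. Z (h i)) - of_nat k * \<mu>"]
      unfolding e B_def by (auto simp: sum_negf abs_if split: if_splits)
    from mult_left_mono[OF this w]
    show "?w h * of_bool (real k * \<rho> < cmod ((\<Sum>i<k. Z (h i)) - of_nat k * \<mu>))
       \<le> ?w h * B R h + ?w h * B (\<lambda>j. - R j) h + ?w h * B M h + ?w h * B (\<lambda>j. - M j) h"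
      by (simp add: algebra_simps)
  qed
  also have "\<dots> \<le> 4 * exp (- (real k * \<rho>\<^sup>2 / 64))"
    unfolding sum.distrib
    using tail[OF R R0] tail[of "\<lambda>j. - R j"] tail[OF M M0] tail[of "\<lambda>j. - M j"] R R0 M M0
    by (simp add: sum_negf)
  finally show ?thesis .
qed

text \<open>The exponential moment is taken at the fixed parameter 1. Convexity replaces
  \<open>exp (- y)\<close> on [0,1] by its chord, which involves only the mean \<open>p\<close>; the
  exponent is thus proportional to \<open>p\<close> rather than \<open>p^2\<close>, so that rare
  events remain detectable. The rate is \<open>5/8 - 1/2 = 1/8\<close>.\<close>

lemma (in prob_space) chernoff_lower_tail:
  fixes Y :: "'a \<Rightarrow> real" and m :: nat
  assumes Y: "Y \<in> borel_measurable M" "\<And>u. u \<in> space M \<Longrightarrow> 0 \<le> Y u" "\<And>u. u \<in> space M \<Longrightarrow> Y u \<le> 1"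
  defines "p \<equiv> expectation Y"
  defines "B \<equiv> {t \<in> space (\<Pi>\<^sub>M l\<in>{..<m}. M). (\<Sum>l<m. Y (t l)) \<le> real m * p / 2}"
  shows "B \<in> sets (\<Pi>\<^sub>M l\<in>{..<m}. M)" "measure (\<Pi>\<^sub>M l\<in>{..<m}. M) B \<le> exp (- (real m * p / 8))"
proof -
  let ?P = "\<Pi>\<^sub>M l\<in>{..<m}. M"
  interpret P: product_prob_space "\<lambda>_. M" "{..<m}" ..
  have [measurable]: "(\<lambda>t. Y (t l)) \<in> borel_measurable ?P" if "l \<in> {..<m}" for l
    by (rule measurable_compose[where f = "\<lambda>t. t l" and N = M, OF measurable_component_singleton Y(1)])
      (use that in auto)
  show Bs: "B \<in> sets ?P" unfolding B_def by measurable
  have Yint: "integrable M Y"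
    by (rule integrable_const_bound[of _ 1]) (use Y in auto)
  have int: "integrable M (\<lambda>u. exp (- Y u))"
    by (rule integrable_const_bound[of _ 1]) (use Y in auto)
  have "expectation (\<lambda>u. exp (- Y u)) \<le> expectation (\<lambda>u. 1 - 5/8 * Y u)"
  proof (intro integral_mono int)
    fix u assume u: "u \<in> space M"
    \<comment> \<open>Equivalent to \<open>8 / 3 <= exp 1\<close>, obtained from the fourth power of
      the quadratic Taylor bound at \<open>1/4\<close>.\<close>
    have e1: "exp (-1) \<le> (3/8 :: real)"
    proof -
      have "8 / 3 \<le> (1 + 1/4 + (1/4)\<^sup>2 / 2 :: real) ^ 4" by (simp add: power2_eq_square power4_eq_xxxx)
      also have "\<dots> \<le> exp (1/4) ^ 4"
        using exp_lower_Taylor_quadratic[of "1/4 :: real"] by (intro power_mono) auto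
      also have "\<dots> = exp 1" by (simp flip: exp_of_nat_mult)
      finally show ?thesis by (simp add: exp_minus field_simps)
    qed
    have "exp (- Y u) = exp ((1 - Y u) *\<^sub>R 0 + Y u *\<^sub>R (-1))" by simp
    also have "\<dots> \<le> (1 - Y u) * exp 0 + Y u * exp (-1)"
      using Y(2,3)[OF u] by (intro convex_onD[OF exp_convex]) auto
    also have "\<dots> \<le> 1 - 5/8 * Y u"
      using mult_left_mono[OF e1 Y(2)[OF u]] by simp
    finally show "exp (- Y u) \<le> 1 - 5/8 * Y u" .
  qed (use Yint in auto)
  also have "\<dots> = 1 - 5/8 * p" using Yint by (simp add: p_def prob_space)
  also have "\<dots> \<le> exp (- (5/8 * p))" using exp_ge_add_one_self[of "- (5/8 * p)"] by simp
  finally have mgf: "expectation (\<lambda>u. exp (- Y u)) \<le> exp (- (5/8 * p))" .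
  have intP: "integrable ?P (\<lambda>t. \<Prod>l<m. exp (- Y (t l)))"
    by (rule P.product_integrable_prod) (use int in auto)
  have "measure ?P B = (\<integral>t. indicator B t \<partial>?P)" using Bs by simp
  also have "\<dots> \<le> (\<integral>t. exp (real m * p / 2) * (\<Prod>l<m. exp (- Y (t l))) \<partial>?P)"
  proof (intro integral_mono)
    show "integrable ?P (indicat_real B)"
      using Bs by (simp add: P.emeasure_finite less_top[symmetric])
    fix t assume "t \<in> space ?P"
    show "indicat_real B t \<le> exp (real m * p / 2) * (\<Prod>l<m. exp (- Y (t l)))"
      by (simp add: exp_sum[symmetric] exp_add[symmetric] sum_negf indicator_def B_def)
  qed (use intP in auto)
  also have "\<dots> = exp (real m * p / 2) * (expectation (\<lambda>u. exp (- Y u))) ^ m"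
    using P.product_integral_prod[of "{..<m}" "\<lambda>_ u. exp (- Y u)"] int by simp
  also have "\<dots> \<le> exp (real m * p / 2) * exp (- (5/8 * p)) ^ m"
    by (intro mult_left_mono power_mono mgf) auto
  also have "\<dots> = exp (- (real m * p / 8))"
    by (simp add: exp_of_nat_mult[symmetric] exp_add[symmetric] field_simps)
  finally show "measure ?P B \<le> exp (- (real m * p / 8))" .
qed

section \<open>Dyadic levels\<close>

text \<open>The levels not exceeding \<open>v\<close> form an initial segment; their geometric sum
  together with the base \<open>a\<close> reaches the first level beyond that segment.\<close>

lemma dyadic_layers_ge:
  fixes v a :: real
  assumes "0 \<le> a" "v \<le> a * 2 ^ n"
  shows "v \<le> a + (\<Sum>i<n. a * 2 ^ i * of_bool (a * 2 ^ i \<le> v))"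
  using assms(2)
proof (induction n)
  case (Suc n)
  show ?case
  proof (cases "v \<le> a * 2 ^ n")
    case True
    with Suc have "v \<le> a + (\<Sum>i<n. a * 2 ^ i * of_bool (a * 2 ^ i \<le> v))" by simp
    also have "\<dots> \<le> a + (\<Sum>i<Suc n. a * 2 ^ i * of_bool (a * 2 ^ i \<le> v))" using assms by simp
    finally show ?thesis .
  next
    case False
    have "a * 2 ^ i \<le> v" if "i < Suc n" for i
    proof -
      have "a * 2 ^ i \<le> a * 2 ^ n" using that assms by (intro mult_left_mono power_increasing) auto
      thus ?thesis using False by simp
    qed
    hence "(\<Sum>i<Suc n. a * 2 ^ i * of_bool (a * 2 ^ i \<le> v)) = a * (\<Sum>i<Suc n. 2 ^ i)"
      unfolding sum_distrib_left by (intro sum.cong) auto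
    also have "\<dots> = a * (2 ^ Suc n - 1)" by (subst geometric_sum) simp_all
    finally show ?thesis using Suc.prems by (simp add: algebra_simps)
  qed
qed simp

text \<open>The largest active level is at most \<open>4 * v\<close>, and the geometric sum up to it
  at most doubles this. The quarter leaves room for passing from a function to an approximation and
  back.\<close>

lemma dyadic_layers_le:
  fixes v a :: real
  assumes "0 \<le> a" "0 \<le> v"
  shows "(\<Sum>i<n. a * 2 ^ i * of_bool (a * 2 ^ i / 4 \<le> v)) \<le> 8 * v"
proof (induction n)
  case (Suc n)
  show ?case
  proof (cases "a * 2 ^ n / 4 \<le> v")
    case True
    have "(\<Sum>i<Suc n. a * 2 ^ i * of_bool (a * 2 ^ i / 4 \<le> v)) \<le> (\<Sum>i<Suc n. a * 2 ^ i)"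
      using assms by (intro sum_mono) auto
    also have "\<dots> = a * (2 ^ Suc n - 1)"
      unfolding sum_distrib_left[symmetric] by (subst geometric_sum) simp_all
    also have "\<dots> \<le> 8 * v" using True assms by (simp add: algebra_simps)
    finally show ?thesis .
  qed (use Suc in simp)
qed (use assms in simp)

text \<open>Starting at 1/2 gives up at most half of a unit second moment.\<close>

definition level :: "nat \<Rightarrow> real" where "level i = 2 ^ i / 2"

text \<open>The part of the second moment that level \<open>i\<close> of \<open>n\<close> may lose.\<close>
definition slack :: "nat \<Rightarrow> nat \<Rightarrow> real" where
  "slack n i = (1 / n + 2 ^ i / 2 ^ n) / 32"

lemma sum_slack_le: "0 < n \<Longrightarrow> (\<Sum>i<n. slack n i) \<le> 1 / 16"
proof -
  assume n: "0 < n"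
  have "(\<Sum>i<n. slack n i) = ((\<Sum>i<n. 1 / real n) + (\<Sum>i<n. 2 ^ i) / 2 ^ n) / 32"
    by (simp add: slack_def sum.distrib sum_divide_distrib[symmetric])
  also have "(\<Sum>i<n. 2 ^ i :: real) = 2 ^ n - 1" by (subst geometric_sum) simp_all
  also have "((\<Sum>i<n. 1 / real n) + (2 ^ n - 1) / 2 ^ n) / 32 \<le> (1 + 1) / (32 :: real)"
    using n by (intro divide_right_mono add_mono) auto
  finally show ?thesis by simp
qed

text \<open>The lower bound makes \<open>2 ^ n / 2\<close> at least \<open>16 * s\<close>, which
  bounds the squared modulus for unit vectors of the cone; the upper bound keeps \<open>n\<close>
  logarithmic in \<open>s\<close>.\<close>

lemma ex_dyadic_scale:
  fixes s :: real
  assumes "1 \<le> s"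
  obtains n :: nat where "32 * s \<le> 2 ^ n" "2 ^ n \<le> 64 * s"
proof -
  define n where "n = (LEAST n. 32 * s \<le> 2 ^ n)"
  have ex: "\<exists>n. 32 * s \<le> 2 ^ n"
    using real_arch_pow[of 2 "32 * s"] by (auto intro: less_imp_le)
  have n: "32 * s \<le> 2 ^ n" unfolding n_def by (rule LeastI_ex[OF ex])
  obtain k where k: "n = Suc k" using n assms by (cases n) auto
  have "\<not> 32 * s \<le> 2 ^ k" using not_less_Least[of k "\<lambda>n. 32 * s \<le> 2 ^ n"] k n_def by auto
  hence "2 ^ n \<le> 64 * s" using k by simp
  with n that show thesis by blast
qed

section \<open>Calibration of the constants in the failure probability\<close>

lemma ln2_gt_half: "1 / 2 < ln (2 :: real)"
proof -
  have "exp (1 / 2 :: real) < 2"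
  proof (rule power2_less_imp_less)
    have "(exp (1 / 2 :: real))\<^sup>2 = exp 1" by (simp flip: exp_of_nat_mult)
    thus "(exp (1 / 2 :: real))\<^sup>2 < 2\<^sup>2" using e_less_272 by simp
  qed simp
  thus ?thesis by (subst ln_exp[symmetric], subst ln_less_cancel_iff) auto
qed

text \<open>Level \<open>i\<close> has \<open>(4 * N) ^ k i\<close> candidate means. The two terms
  of \<open>slack\<close> split the Chernoff exponent into \<open>m / (128 * n * 2^i)\<close>, which
  absorbs the logarithm of this count, and \<open>W = m / (128 * 2^n)\<close>, which is the same for
  all levels and yields \<gamma> after summation.\<close>

lemma failure_sum_less:
  fixes s \<gamma> :: real and n \<kappa> N :: nat
  defines "k i \<equiv> \<kappa> * 2 ^ (n - i)"
  assumes s: "2 \<le> s" and n: "32 * s \<le> 2 ^ n" "2 ^ n \<le> 64 * s"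
    and \<kappa>: "real \<kappa> \<le> 4096 * ln (4096 * s) + 1"
    and N: "2 \<le> N" and \<gamma>: "0 < \<gamma>" "\<gamma> < 1"
    and m: "10 ^ 11 * s * max ((ln s) ^ 3 * ln (real N)) (ln (1 / \<gamma>)) \<le> real m"
  shows "(\<Sum>i<n. (4 * real N) ^ k i * exp (- (real m * (slack n i / level i) / 8))) < \<gamma>"
proof -
  define L where "L = ln s"
  define b where "b = ln (real N)"
  have L: "1 / 2 < L" using ln2_gt_half s unfolding L_def by (smt (verit) ln_le_cancel_iff)
  have b: "1 / 2 < b" 
  proof -
    have "ln 2 \<le> b" using N by (simp add: b_def)
    thus ?thesis using ln2_gt_half by linarith
  qed
  have n0: "0 < n" using n s by (cases n) auto
  have ln2: "ln 2 \<le> L" unfolding L_def using s by simp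
  \<comment> \<open>\<open>2 ^ n <= 64 * s\<close> and \<open>ln 2 <= L\<close> give
    \<open>n * ln 2 <= 7 * L\<close>; dividing by \<open>ln 2 > 1/2\<close> produces the 14.\<close>
  have "real n * ln 2 = ln (2 ^ n)" by (simp add: ln_realpow)
  also have "\<dots> \<le> ln (64 * s)" using n s by (subst ln_le_cancel_iff) auto
  also have "\<dots> = ln (2 ^ 6) + L" using s by (simp add: L_def ln_mult)
  also have "\<dots> = 6 * ln 2 + L" by (subst ln_realpow) auto
  finally have "real n * ln 2 \<le> 7 * L" using ln2 by simp
  moreover have "real n * (1 / 2) \<le> real n * ln 2" using ln2_gt_half by (intro mult_left_mono) auto
  ultimately have nL: "real n \<le> 14 * L" by simp
  \<comment> \<open>\<open>4096 = 2 ^ 12\<close> gives \<open>ln (4096 * s) <= 13 * L\<close>, and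
    \<open>4096 * 13 = 53248\<close>; the additive 1 is at most \<open>2 * L\<close>.\<close>
  have "ln (4096 * s) = ln (2 ^ 12) + L" using s by (simp add: L_def ln_mult)
  also have "\<dots> = 12 * ln 2 + L" by (subst ln_realpow) auto
  finally have \<kappa>L: "real \<kappa> \<le> 53250 * L" using \<kappa> ln2 L by simp
  have "ln (4 * real N) \<le> ln (real N ^ 3)"
  proof (subst ln_le_cancel_iff)
    have "2 * 2 * real N \<le> real N * real N * real N" using N by (intro mult_mono) auto
    thus "4 * real N \<le> real N ^ 3" by (simp add: power3_eq_cube)
  qed (use N in auto)
  also have "\<dots> = 3 * b" using N by (simp add: b_def ln_realpow)
  finally have b4: "ln (4 * real N) \<le> 3 * b" .
  have ge1: "10 ^ 11 * s * (L ^ 3 * b) \<le> real m"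
    using s m by (intro order.trans[OF mult_left_mono m]) (auto simp: L_def b_def)
  have ge2: "10 ^ 11 * s * ln (1 / \<gamma>) \<le> real m"
    using s m by (intro order.trans[OF mult_left_mono m]) auto
  \<comment> \<open>One factor \<open>L\<close> comes from \<open>n\<close> and one from
    \<open>\<kappa>\<close>; \<open>1 <= 2 * L\<close> brings the product to the form
    \<open>L ^ 3\<close> of the assumption on \<open>m\<close>.\<close>
  have union: "128 * real n * real \<kappa> * 2 ^ n * ln (4 * real N) \<le> real m"
  proof -
    have "128 * real n * real \<kappa> * 2 ^ n * ln (4 * real N) \<le> 128 * (14 * L) * (53250 * L) * (64 * s) * (3 * b)"
      using nL \<kappa>L n b4 L b s N by (intro mult_mono) (auto intro!: ln_ge_zero)
    also have "\<dots> = 18321408000 * (s * L\<^sup>2 * b) * 1" by (simp add: power2_eq_square)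
    also have "\<dots> \<le> 18321408000 * (s * L\<^sup>2 * b) * (2 * L)"
      using L b s by (intro mult_left_mono) auto
    also have "\<dots> = 36642816000 * (s * L ^ 3 * b)" by (simp add: power2_eq_square power3_eq_cube)
    also have "\<dots> \<le> 10 ^ 11 * (s * L ^ 3 * b)" using L b s by (intro mult_right_mono) auto
    also have "\<dots> \<le> real m" using ge1 by (simp add: mult_ac)
    finally show ?thesis .
  qed
  define W where "W = real m / (128 * 2 ^ n)"
  have term_le: "(4 * real N) ^ k i * exp (- (real m * (slack n i / level i) / 8)) \<le> exp (- W)" if i: "i < n" for i
  proof -
    have "(4 * real N) ^ k i = exp (real (k i) * ln (4 * real N))"
      using N by (subst exp_of_nat_mult) simp
    moreover have "real m * (slack n i / level i) / 8 = real m / (128 * real n * 2 ^ i) + W"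
    proof -
      have "slack n i / level i = (1 / (real n * 2 ^ i) + 1 / 2 ^ n) / 16"
        using n0 by (simp add: slack_def level_def divide_simps)
      thus ?thesis unfolding W_def by (simp add: distrib_left add_divide_distrib)
    qed
    moreover have "real (k i) * ln (4 * real N) \<le> real m / (128 * real n * 2 ^ i)"
    proof -
      have "(2::real) ^ n = 2 ^ (n - i) * 2 ^ i" using i by (simp flip: power_add)
      hence "real (k i) * ln (4 * real N) = 128 * real n * real \<kappa> * 2 ^ n * ln (4 * real N) / (128 * real n * 2 ^ i)"
        using n0 by (simp add: k_def field_simps)
      also have "\<dots> \<le> real m / (128 * real n * 2 ^ i)" using union by (intro divide_right_mono) auto
      finally show ?thesis .
    qed
    ultimately show ?thesis by (simp flip: exp_add)
  qed
  have "14 * L + ln (1 / \<gamma>) \<le> real m / (8192 * s)"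
  proof -
    \<comment> \<open>The factor \<open>5 * 10 ^ 6\<close> is such that
      \<open>8192 * 5 * 10 ^ 6\<close> stays below half of \<open>10 ^ 11\<close>: the two lower
      bounds on \<open>m\<close> are used with half weight each.\<close>
    have "14 * L \<le> 5 * 10 ^ 6 * (L ^ 3 * b)"
    proof -
      have "1 / 8 \<le> L * L * b"
        using mult_mono[OF mult_mono[of "1/2" L "1/2" L] less_imp_le[OF b]] L by simp
      hence "L * (1 / 8) \<le> L * (L * L * b)" using L by (intro mult_left_mono) auto
      thus ?thesis using L by (simp add: power3_eq_cube mult.assoc)
    qed
    moreover have "0 \<le> ln (1 / \<gamma>)" using \<gamma> by simp
    ultimately have "8192 * s * (14 * L + ln (1 / \<gamma>)) \<le> 8192 * s * (5 * 10 ^ 6 * (L ^ 3 * b) + 5 * 10 ^ 6 * ln (1 / \<gamma>))"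
      using s by (intro mult_left_mono add_mono) auto
    also have "\<dots> \<le> (10 ^ 11 * s * (L ^ 3 * b) + 10 ^ 11 * s * ln (1 / \<gamma>)) / 2"
      using s L b \<open>0 \<le> ln (1 / \<gamma>)\<close> by (simp add: algebra_simps add_mono mult_right_mono)
    also have "\<dots> \<le> real m" using ge1 ge2 by simp
    finally show ?thesis using s by (simp add: pos_le_divide_eq mult.commute)
  qed
  also have "\<dots> \<le> W" unfolding W_def using n s by (intro divide_left_mono) auto
  finally have "exp (- W) \<le> exp (- (14 * L + ln (1 / \<gamma>)))" by simp
  also have "\<dots> = exp (- (14 * L)) * \<gamma>" using \<gamma> by (simp add: exp_diff exp_minus ln_div field_simps)
  finally have eW: "exp (- W) \<le> exp (- (14 * L)) * \<gamma>" .
  have "(\<Sum>i<n. (4 * real N) ^ k i * exp (- (real m * (slack n i / level i) / 8))) \<le> (\<Sum>i<n. exp (- W))"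
    using term_le by (intro sum_mono) auto
  also have "\<dots> \<le> 14 * L * (exp (- (14 * L)) * \<gamma>)"
    using nL eW by (auto intro!: mult_mono)
  \<comment> \<open>The number of levels is absorbed by the reserve \<open>exp (- (14 * L))\<close>
    kept in \<open>W\<close>.\<close>
  also have "\<dots> < exp (14 * L) * (exp (- (14 * L)) * \<gamma>)"
  proof (rule mult_strict_right_mono)
    show "14 * L < exp (14 * L)" using exp_ge_add_one_self[of "14 * L"] by linarith
  qed (use \<gamma> in simp)
  also have "\<dots> = \<gamma>" by (simp add: exp_minus)
  finally show ?thesis .
qed

section \<open>Maurey approximation in a bounded orthonormal system\<close>

text \<open>First-moment step of the probabilistic method: otherwise the weighted excesses over
  \<open>c\<close> would all vanish, forcing every weight to be zero.\<close>

lemma ex_le_weighted_mean: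
  fixes w F :: "'b \<Rightarrow> real"
  assumes "finite H" "\<And>h. h \<in> H \<Longrightarrow> 0 \<le> w h" "sum w H = 1" "(\<Sum>h\<in>H. w h * F h) \<le> c"
  shows "\<exists>h\<in>H. F h \<le> c"
proof (rule ccontr)
  assume "\<not> ?thesis"
  hence less: "c < F h" if "h \<in> H" for h using that by force
  have nonneg: "0 \<le> w h * (F h - c)" if "h \<in> H" for h
    using assms(2)[OF that] less[OF that] by simp
  have "(\<Sum>h\<in>H. w h * (F h - c)) \<le> 0"
    using assms(3,4) by (simp add: right_diff_distrib sum_subtractf flip: sum_distrib_right)
  hence "(\<Sum>h\<in>H. w h * (F h - c)) = 0" using nonneg by (intro antisym sum_nonneg)
  hence "w h * (F h - c) = 0" if "h \<in> H" for h
    using sum_nonneg_eq_0_iff[OF assms(1) nonneg] that by auto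
  hence "w h = 0" if "h \<in> H" for h using less[OF that] that by force
  thus False using assms(3) by simp
qed

text \<open>Nonnegative combinations of these units give every complex number, so complex
  coefficients can be turned into probabilities on a finite dictionary.\<close>

definition units4 :: "complex set" where "units4 = {1, -1, \<i>, -\<i>}"

lemma sum_units4: "sum g units4 = g 1 + g (-1) + g \<i> + g (-\<i>)"
  for g :: "complex \<Rightarrow> 'a :: comm_monoid_add"
  by (simp add: units4_def complex_eq_iff add.assoc)

lemma units4: "finite units4" "card units4 = 4" "u \<in> units4 \<Longrightarrow> cmod u = 1"
  by (auto simp: units4_def) (simp add: complex_eq_iff)

text \<open>The numbers \<open>Re (z * cnj v)\<close> are plus and minus the real and imaginary
  parts of \<open>z\<close>; their positive parts are the coefficients of \<open>z\<close> along the
  units.\<close>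

lemma sum_units4_positive_parts:
  "(\<Sum>v\<in>units4. max 0 (Re (z * cnj v))) = \<bar>Re z\<bar> + \<bar>Im z\<bar>"
  "(\<Sum>v\<in>units4. of_real (max 0 (Re (z * cnj v))) * v) = z"
  "(\<Sum>v\<in>units4. v) = 0"
  unfolding sum_units4 by (auto simp: complex_eq_iff max_def)

section \<open>Weighted orthonormal systems: pointwise bounds and Parseval's identity\<close>

locale weighted_orthonormal_system =
  fixes D :: "'a set" and \<nu> :: "'a measure" and \<Lambda> :: "'i set"
    and \<psi> :: "'i \<Rightarrow> 'a \<Rightarrow> complex" and \<omega> :: "'i \<Rightarrow> real"
  assumes finite_index: "finite \<Lambda>"
    and nonempty_index: "\<Lambda> \<noteq> {}"
    and orthonormal: "orthonormal_system D \<nu> \<Lambda> \<psi>"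
    and weight_ge_1: "j \<in> \<Lambda> \<Longrightarrow> 1 \<le> \<omega> j"
    and weight_ge_sup_norm: "j \<in> \<Lambda> \<Longrightarrow> sup_norm D (\<psi> j) \<le> ereal (\<omega> j)"
begin

sublocale prob_space \<nu>
  using orthonormal by (simp add: orthonormal_system_def)

lemma space_eq: "space \<nu> = D"
  using orthonormal by (simp add: orthonormal_system_def)

lemma measurable_\<psi>: "j \<in> \<Lambda> \<Longrightarrow> \<psi> j \<in> borel_measurable \<nu>"
  using orthonormal by (simp add: orthonormal_system_def)

lemma cmod_\<psi>_le:
  assumes "j \<in> \<Lambda>" "u \<in> D" shows "cmod (\<psi> j u) \<le> \<omega> j"
proof -
  have "ereal (cmod (\<psi> j u)) \<le> sup_norm D (\<psi> j)"
    unfolding sup_norm_def using assms by (intro SUP_upper) auto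
  also have "\<dots> \<le> ereal (\<omega> j)" by (rule weight_ge_sup_norm) fact
  finally show ?thesis by simp
qed

lemma measurable_expansion: "expansion \<Lambda> \<psi> x \<in> borel_measurable \<nu>"
  unfolding expansion_def using measurable_\<psi> by (intro borel_measurable_sum borel_measurable_times) auto

lemma cmod_expansion_le:
  assumes "u \<in> D" shows "cmod (expansion \<Lambda> \<psi> x u) \<le> weighted_l1 \<Lambda> \<omega> x"
  unfolding expansion_def weighted_l1_def
  by (intro order.trans[OF norm_sum] sum_mono)
    (use cmod_\<psi>_le assms in \<open>auto simp: norm_mult mult.commute[of "\<omega> _"] intro: mult_left_mono\<close>)

lemma parseval: "has_bochner_integral \<nu> (\<lambda>u. (cmod (expansion \<Lambda> \<psi> x u))\<^sup>2) (\<Sum>j\<in>\<Lambda>. (cmod (x j))\<^sup>2)"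
proof -
  have "has_bochner_integral \<nu> (\<lambda>u. \<Sum>j\<in>\<Lambda>. \<Sum>k\<in>\<Lambda>. (x j * cnj (x k)) * (\<psi> j u * cnj (\<psi> k u)))
     (\<Sum>j\<in>\<Lambda>. \<Sum>k\<in>\<Lambda>. (x j * cnj (x k)) * (if j = k then 1 else 0))"
    using orthonormal
    by (intro has_bochner_integral_sum has_bochner_integral_mult_right) (auto simp: orthonormal_system_def)
  also have "(\<Sum>j\<in>\<Lambda>. \<Sum>k\<in>\<Lambda>. (x j * cnj (x k)) * (if j = k then 1 else 0))
      = of_real (\<Sum>j\<in>\<Lambda>. (cmod (x j))\<^sup>2)"
    unfolding of_real_sum complex_norm_square
    by (intro sum.cong) (auto simp: finite_index if_distrib[of "(*) _"] sum.delta cong: if_cong)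
  also have "(\<lambda>u. \<Sum>j\<in>\<Lambda>. \<Sum>k\<in>\<Lambda>. (x j * cnj (x k)) * (\<psi> j u * cnj (\<psi> k u)))
     = (\<lambda>u. of_real ((cmod (expansion \<Lambda> \<psi> x u))\<^sup>2))"
    unfolding complex_norm_square expansion_def by (simp add: sum_product mult_ac)
  finally show ?thesis
    by (auto dest: has_bochner_integral_bounded_linear[OF bounded_linear_Re])
qed

text \<open>Dividing by the weight makes each element bounded by 1 on the domain, since the weights
  dominate the sup norms. A bound on the weighted l1 norm then places an expansion in a multiple of
  the convex hull of the dictionary.\<close>

definition dict_elem :: "'i \<times> complex \<Rightarrow> 'a \<Rightarrow> complex" where
  "dict_elem p u = snd p * \<psi> (fst p) u / of_real (\<omega> (fst p))"

definition dict_mean :: "real \<Rightarrow> nat \<Rightarrow> (nat \<Rightarrow> 'i \<times> complex) \<Rightarrow> 'a \<Rightarrow> complex" where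
  "dict_mean K k h u = of_real (K / real k) * (\<Sum>i<k. dict_elem (h i) u)"

lemma cmod_dict_elem_le:
  assumes "p \<in> \<Lambda> \<times> units4" "u \<in> D" shows "cmod (dict_elem p u) \<le> 1"
  using assms cmod_\<psi>_le[of "fst p" u] weight_ge_1[of "fst p"]
  by (auto simp: dict_elem_def norm_mult norm_divide units4(3))

lemma measurable_dict_mean:
  assumes "h \<in> PiE {..<k} (\<lambda>_. \<Lambda> \<times> units4)"
  shows "dict_mean K k h \<in> borel_measurable \<nu>"
  unfolding dict_mean_def dict_elem_def using assms measurable_\<psi>
  by (intro borel_measurable_times borel_measurable_sum borel_measurable_divide borel_measurable_const)
    (auto simp: PiE_iff mem_Times_iff)

text \<open>
  The mass left over by \<open>x\<close> is spread evenly over the dictionary; it contributes nothing since the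
  four units sum to zero.
\<close>
lemma ex_dict_weights:
  assumes K: "0 < K" and x: "weighted_l1 \<Lambda> \<omega> x \<le> K / 2"
  obtains q where "\<And>p. p \<in> \<Lambda> \<times> units4 \<Longrightarrow> 0 \<le> q p" "sum q (\<Lambda> \<times> units4) = 1"
    "\<And>u. (\<Sum>p\<in>\<Lambda> \<times> units4. of_real (q p) * dict_elem p u) = expansion \<Lambda> \<psi> x u / of_real K"
proof -
  define T where "T = (\<Sum>j\<in>\<Lambda>. \<omega> j * (\<bar>Re (x j)\<bar> + \<bar>Im (x j)\<bar>))"
  define e where "e = (K - T) / (4 * real (card \<Lambda>))"
  define q where "q = (\<lambda>(j, u). (\<omega> j * max 0 (Re (x j * cnj u)) + e) / K)"
  have N: "0 < card \<Lambda>" using finite_index nonempty_index by (simp add: card_gt_0_iff)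
  \<comment> \<open>Splitting coefficients among the units costs at most a factor 2 in mass, so the
    bound \<open>K / 2\<close> leaves \<open>T <= K\<close>.\<close>
  have "T \<le> (\<Sum>j\<in>\<Lambda>. \<omega> j * (2 * cmod (x j)))"
    unfolding T_def
  proof (intro sum_mono mult_left_mono)
    fix j assume "j \<in> \<Lambda>"
    show "\<bar>Re (x j)\<bar> + \<bar>Im (x j)\<bar> \<le> 2 * cmod (x j)"
      using abs_Re_le_cmod[of "x j"] abs_Im_le_cmod[of "x j"] by linarith
    show "0 \<le> \<omega> j" using weight_ge_1[OF \<open>j \<in> \<Lambda>\<close>] by simp
  qed
  also have "\<dots> = 2 * weighted_l1 \<Lambda> \<omega> x" by (simp add: weighted_l1_def sum_distrib_left mult_ac)
  finally have e0: "0 \<le> e" using x N by (simp add: e_def)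
  show thesis
  proof
    fix p assume "p \<in> \<Lambda> \<times> units4"
    thus "0 \<le> q p" using e0 K weight_ge_1 by (fastforce simp: q_def)
  next
    have "sum q (\<Lambda> \<times> units4) = (\<Sum>j\<in>\<Lambda>. \<Sum>u\<in>units4. q (j, u))"
      by (simp add: sum.cartesian_product)
    also have "\<dots> = (\<Sum>j\<in>\<Lambda>. (\<omega> j * (\<bar>Re (x j)\<bar> + \<bar>Im (x j)\<bar>) + 4 * e) / K)"
      unfolding q_def prod.case
      by (simp only: sum_divide_distrib[symmetric] sum.distrib sum_distrib_left[symmetric]
          sum_units4_positive_parts sum_constant units4) simp
    also have "\<dots> = (T + 4 * e * card \<Lambda>) / K"
      by (simp add: T_def sum.distrib sum_divide_distrib[symmetric])
    also have "4 * e * card \<Lambda> = K - T" using N by (simp add: e_def)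
    also have "(T + (K - T)) / K = 1" using K by simp
    finally show "sum q (\<Lambda> \<times> units4) = 1" .
  next
    fix u
    have "(\<Sum>p\<in>\<Lambda> \<times> units4. of_real (q p) * dict_elem p u)
        = (\<Sum>j\<in>\<Lambda>. \<Sum>v\<in>units4. of_real (q (j, v)) * dict_elem (j, v) u)"
      by (simp add: sum.cartesian_product)
    also have "\<dots> = (\<Sum>j\<in>\<Lambda>. x j * \<psi> j u / of_real K)"
    proof (intro sum.cong refl)
      fix j assume j: "j \<in> \<Lambda>"
      have \<omega>: "\<omega> j \<noteq> 0" using weight_ge_1[OF j] by auto
      have "(\<Sum>v\<in>units4. of_real (q (j, v)) * dict_elem (j, v) u)
          = (\<Sum>v\<in>units4. of_real (q (j, v)) * v) * (\<psi> j u / of_real (\<omega> j))"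
        unfolding sum_distrib_right by (intro sum.cong) (simp_all add: dict_elem_def mult_ac)
      also have "(\<Sum>v\<in>units4. of_real (q (j, v)) * v) = of_real (\<omega> j / K) *
          (\<Sum>v\<in>units4. of_real (max 0 (Re (x j * cnj v))) * v) + of_real (e / K) * (\<Sum>v\<in>units4. v)"
        unfolding sum_distrib_left sum.distrib[symmetric]
        by (intro sum.cong) (simp_all add: q_def add_divide_distrib distrib_right del: mult_minus_left)
      also have "\<dots> = of_real (\<omega> j / K) * x j"
        unfolding sum_units4_positive_parts by simp
      finally show "(\<Sum>v\<in>units4. of_real (q (j, v)) * dict_elem (j, v) u) = x j * \<psi> j u / of_real K"
        using \<omega> by simp
    qed
    also have "\<dots> = expansion \<Lambda> \<psi> x u / of_real K"
      by (simp add: expansion_def sum_divide_distrib)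
    finally show "(\<Sum>p\<in>\<Lambda> \<times> units4. of_real (q p) * dict_elem p u) = expansion \<Lambda> \<psi> x u / of_real K" .
  qed
qed

text \<open>Maurey's empirical method, with respect to the measure and the sample simultaneously.\<close>
lemma maurey_approximation:
  assumes K: "0 < K" and x: "weighted_l1 \<Lambda> \<omega> x \<le> K / 2"
    and k: "0 < k" and r: "0 \<le> r" "r \<le> 32 * K"
    and t: "\<And>l. l < m \<Longrightarrow> t l \<in> D" and m: "0 < m"
  shows "\<exists>h\<in>PiE {..<k} (\<lambda>_. \<Lambda> \<times> units4).
     measure \<nu> {u \<in> D. r / 4 < cmod (expansion \<Lambda> \<psi> x u - dict_mean K k h u)}
     + (\<Sum>l<m. of_bool (r / 4 < cmod (expansion \<Lambda> \<psi> x (t l) - dict_mean K k h (t l)))) / real m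
     \<le> 8 * exp (- (real k * (r / (4 * K))\<^sup>2 / 64))"
proof -
  obtain q where q: "\<And>p. p \<in> \<Lambda> \<times> units4 \<Longrightarrow> 0 \<le> q p" "sum q (\<Lambda> \<times> units4) = 1"
    "\<And>u. (\<Sum>p\<in>\<Lambda> \<times> units4. of_real (q p) * dict_elem p u) = expansion \<Lambda> \<psi> x u / of_real K"
    using ex_dict_weights[OF K x] by metis
  define H where "H = PiE {..<k} (\<lambda>_. \<Lambda> \<times> units4)"
  define w where "w = (\<lambda>h. \<Prod>i<k. q (h i))"
  define c where "c = 4 * exp (- (real k * (r / (4 * K))\<^sup>2 / 64))"
  define bad where "bad = (\<lambda>h u. r / 4 < cmod (expansion \<Lambda> \<psi> x u - dict_mean K k h u))"
  have finJ: "finite (\<Lambda> \<times> units4)" using finite_index units4 by simp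
  have finH: "finite H" unfolding H_def by (intro finite_PiE finJ) simp
  have w0: "0 \<le> w h" if "h \<in> H" for h
    using that q(1) unfolding w_def H_def by (intro prod_nonneg ballI q(1)) blast
  have w1: "sum w H = 1"
    unfolding w_def H_def
    using prod_sum_PiE[of "{..<k}" "\<lambda>_. \<Lambda> \<times> units4" "\<lambda>_. q"] finJ q(2) by simp
  \<comment> \<open>At a fixed point the random elements take i.i.d. values with mean
    \<open>expansion \<Lambda> \<psi> x u / K\<close>, and the approximation error is
    \<open>K\<close> times the deviation of their average. The tail bound applies with
    \<open>\<rho> = r / (4 * K)\<close>, for which \<open>r <= 32 * K\<close> is the range
    condition.\<close>
  have pointwise: "(\<Sum>h\<in>H. w h * of_bool (bad h u)) \<le> c" if u: "u \<in> D" for u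
  proof -
    have "bad h u \<longleftrightarrow> real k * (r / (4 * K)) < cmod ((\<Sum>i<k. dict_elem (h i) u)
        - of_nat k * (\<Sum>p\<in>\<Lambda> \<times> units4. of_real (q p) * dict_elem p u))" for h
    proof -
      have "expansion \<Lambda> \<psi> x u - dict_mean K k h u
         = - of_real (K / k) * ((\<Sum>i<k. dict_elem (h i) u) - of_nat k * (expansion \<Lambda> \<psi> x u / of_real K))"
        using K k by (simp add: dict_mean_def field_simps)
      hence "cmod (expansion \<Lambda> \<psi> x u - dict_mean K k h u)
        = K / k * cmod ((\<Sum>i<k. dict_elem (h i) u) - of_nat k * (expansion \<Lambda> \<psi> x u / of_real K))"
        using K by (simp only: norm_mult norm_minus_cancel norm_of_real) simp
      moreover have "r / 4 < K / k * X \<longleftrightarrow> real k * (r / (4 * K)) < X" for X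
        using K k by (simp add: field_simps)
      ultimately show ?thesis unfolding bad_def q(3) by simp
    qed
    thus ?thesis
      unfolding w_def H_def c_def
      using iid_complex_sum_tail[OF finJ q(1,2) cmod_dict_elem_le[OF _ u], where \<rho> = "r / (4 * K)" and k = k] K r
      by (simp add: field_simps)
  qed
  have meas: "{u \<in> D. bad h u} \<in> sets \<nu>" if "h \<in> H" for h
  proof -
    have [measurable]: "dict_mean K k h \<in> borel_measurable \<nu>" "expansion \<Lambda> \<psi> x \<in> borel_measurable \<nu>"
      using that measurable_dict_mean measurable_expansion by (auto simp: H_def)
    show ?thesis unfolding bad_def space_eq[symmetric] by measurable
  qed
  have int: "integrable \<nu> (\<lambda>u. w h * indicator {u \<in> D. bad h u} u)" if "h \<in> H" for h
    using meas[OF that] by (intro integrable_mult_right) (auto simp: emeasure_finite less_top[symmetric])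
  have "(\<Sum>h\<in>H. w h * measure \<nu> {u \<in> D. bad h u}) = (\<integral>u. (\<Sum>h\<in>H. w h * indicator {u \<in> D. bad h u} u) \<partial>\<nu>)"
    using int meas by (subst Bochner_Integration.integral_sum) (auto intro!: sum.cong)
  also have "\<dots> \<le> (\<integral>u. c \<partial>\<nu>)"
  proof (intro integral_mono)
    show "integrable \<nu> (\<lambda>u. \<Sum>h\<in>H. w h * indicat_real {u \<in> D. bad h u} u)"
      using int by auto
    fix u assume u: "u \<in> space \<nu>"
    thus "(\<Sum>h\<in>H. w h * indicat_real {u \<in> D. bad h u} u) \<le> c"
      using pointwise[of u] by (simp add: space_eq indicator_def)
  qed simp
  finally have p1: "(\<Sum>h\<in>H. w h * measure \<nu> {u \<in> D. bad h u}) \<le> c" by (simp add: prob_space)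
  have "(\<Sum>h\<in>H. w h * ((\<Sum>l<m. of_bool (bad h (t l))) / real m))
      = (\<Sum>l<m. \<Sum>h\<in>H. w h * of_bool (bad h (t l))) / real m"
    unfolding sum_distrib_left sum_divide_distrib times_divide_eq_right by (rule sum.swap)
  also have "\<dots> \<le> (\<Sum>l<m. c) / real m"
    using pointwise t by (intro divide_right_mono sum_mono) auto
  finally have p2: "(\<Sum>h\<in>H. w h * ((\<Sum>l<m. of_bool (bad h (t l))) / real m)) \<le> c"
    using m by simp
  \<comment> \<open>The measure and the sample fraction of the bad set each have mean at most
    \<open>c\<close> over the tuples; selecting a tuple for their sum makes both small at
    once.\<close>
  have "\<exists>h\<in>H. measure \<nu> {u \<in> D. bad h u} + (\<Sum>l<m. of_bool (bad h (t l))) / real m \<le> c + c"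
    using p1 p2 by (intro ex_le_weighted_mean[OF finH w0 w1]) (auto simp: distrib_left sum.distrib)
  thus ?thesis by (simp add: H_def bad_def c_def)
qed

section \<open>The lower bound on the cone\<close>

text \<open>\<open>8 * sqrt s\<close> is twice the norm bound of the cone, as the Maurey step
  requires. With an error of at most a quarter of \<open>sqrt (level i)\<close>, the factor 3/4
  turns function values above this root into exceedances, and exceedances into function values above
  half of it.\<close>

definition exceed :: "real \<Rightarrow> nat \<Rightarrow> nat \<Rightarrow> (nat \<Rightarrow> 'i \<times> complex) \<Rightarrow> 'a \<Rightarrow> bool" where
  "exceed s k i h u \<longleftrightarrow> 3 / 4 * sqrt (level i) \<le> cmod (dict_mean (8 * sqrt s) k h u)"

text \<open>Only the finitely many dictionary means enter, never a vector \<open>x\<close>, so that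
  one event serves all vectors. Levels contributing less than \<open>slack\<close> are exempt
  because their Chernoff exponent may be too small for the union bound.\<close>

definition good_sample :: "real \<Rightarrow> nat \<Rightarrow> (nat \<Rightarrow> nat) \<Rightarrow> nat \<Rightarrow> (nat \<Rightarrow> 'a) \<Rightarrow> bool" where
  "good_sample s n k m t \<longleftrightarrow>
     (\<forall>i<n. \<forall>h\<in>PiE {..<k i} (\<lambda>_. \<Lambda> \<times> units4).
        slack n i \<le> level i * measure \<nu> {u \<in> D. exceed s (k i) i h u} \<longrightarrow>
        real m * measure \<nu> {u \<in> D. exceed s (k i) i h u} / 2 \<le> (\<Sum>l<m. of_bool (exceed s (k i) i h (t l))))"

lemma measurable_exceed:
  assumes "h \<in> PiE {..<k} (\<lambda>_. \<Lambda> \<times> units4)"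
  shows "{u \<in> D. exceed s k i h u} \<in> sets \<nu>"
proof -
  have [measurable]: "dict_mean (8 * sqrt s) k h \<in> borel_measurable \<nu>"
    by (rule measurable_dict_mean) fact
  show ?thesis unfolding exceed_def space_eq[symmetric] by measurable
qed

text \<open>The pointwise layer inequality with base 1/2 is integrated; the norm hypothesis keeps
  the squared modulus below \<open>2 ^ n / 2\<close>.\<close>

lemma second_moment_layers:
  assumes x: "(\<Sum>j\<in>\<Lambda>. (cmod (x j))\<^sup>2) = 1" and bd: "(weighted_l1 \<Lambda> \<omega> x)\<^sup>2 \<le> 2 ^ n / 2"
  shows "1 / 2 \<le> (\<Sum>i<n. level i * measure \<nu> {u \<in> D. level i \<le> (cmod (expansion \<Lambda> \<psi> x u))\<^sup>2})"
proof -
  let ?v = "\<lambda>u. (cmod (expansion \<Lambda> \<psi> x u))\<^sup>2"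
  have [measurable]: "expansion \<Lambda> \<psi> x \<in> borel_measurable \<nu>" by (rule measurable_expansion)
  have meas: "{u \<in> D. level i \<le> ?v u} \<in> sets \<nu>" for i
    unfolding space_eq[symmetric] by measurable
  have int: "integrable \<nu> (\<lambda>u. level i * indicator {u \<in> D. level i \<le> ?v u} u)" for i
    using meas by (intro integrable_mult_right) (auto simp: emeasure_finite less_top[symmetric])
  have "1 = (\<integral>u. ?v u \<partial>\<nu>)"
    using has_bochner_integral_integral_eq[OF parseval[of x]] x by simp
  also have "\<dots> \<le> (\<integral>u. 1 / 2 + (\<Sum>i<n. level i * indicator {u \<in> D. level i \<le> ?v u} u) \<partial>\<nu>)"
  proof (intro integral_mono)
    show "integrable \<nu> ?v" using parseval has_bochner_integral_iff by blast
    show "integrable \<nu> (\<lambda>u. 1 / 2 + (\<Sum>i<n. level i * indicat_real {u \<in> D. level i \<le> ?v u} u))"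
      by (intro Bochner_Integration.integrable_add Bochner_Integration.integrable_sum int integrable_const)
    fix u assume "u \<in> space \<nu>"
    hence u: "u \<in> D" by (simp add: space_eq)
    have "?v u \<le> (weighted_l1 \<Lambda> \<omega> x)\<^sup>2"
      using cmod_expansion_le[OF u] by (intro power_mono) auto
    hence "?v u \<le> 1 / 2 * 2 ^ n" using bd by simp
    from dyadic_layers_ge[OF _ this]
    show "?v u \<le> 1 / 2 + (\<Sum>i<n. level i * indicat_real {u \<in> D. level i \<le> ?v u} u)"
      using u by (simp add: level_def indicator_def)
  qed
  also have "\<dots> = 1 / 2 + (\<Sum>i<n. level i * measure \<nu> {u \<in> D. level i \<le> ?v u})"
    by (subst Bochner_Integration.integral_add)
      (simp_all only: Bochner_Integration.integral_sum[OF int] Bochner_Integration.integrable_sum[OF int]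
        integrable_const, simp add: prob_space meas)
  finally show ?thesis by simp
qed

text \<open>At each level the comparison runs from the measure for the function to that for a Maurey
  mean, across to the sample frequency of the same mean by \<open>good_sample\<close>, and back to
  the function at a quarter of the level. The mean may depend on both \<open>x\<close> and
  \<open>t\<close>, since \<open>good_sample\<close> covers all tuples.\<close>

lemma good_sample_lower_bound:
  fixes \<kappa> :: nat
  defines "k n i \<equiv> \<kappa> * 2 ^ (n - i)"
  assumes s: "1 \<le> s" "32 * s \<le> 2 ^ n" "2 ^ n \<le> 64 * s"
    and \<kappa>: "4096 * ln (4096 * s) \<le> real \<kappa>"
    and x: "(\<Sum>j\<in>\<Lambda>. (cmod (x j))\<^sup>2) = 1" "weighted_l1 \<Lambda> \<omega> x \<le> 4 * sqrt s"
    and m: "0 < m" and t: "\<And>l. l < m \<Longrightarrow> t l \<in> D"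
    and good: "good_sample s n (k n) m t"
  shows "real m / 64 \<le> (\<Sum>l<m. (cmod (expansion \<Lambda> \<psi> x (t l)))\<^sup>2)"
proof -
  let ?f = "expansion \<Lambda> \<psi> x"
  define P where "P = (\<lambda>Q. (\<Sum>l<m. of_bool (Q (t l))) / real m :: real)"
  have P_mono: "P Q \<le> P Q' + P Q''" if "\<And>u. u \<in> D \<Longrightarrow> Q u \<Longrightarrow> Q' u \<or> Q'' u" for Q Q' Q''
    unfolding P_def add_divide_distrib[symmetric] sum.distrib[symmetric]
    using that t by (intro divide_right_mono sum_mono) auto
  have n: "0 < n" using s by (cases n) auto
  have \<kappa>0: "0 < \<kappa>"
  proof -
    have "0 < ln (4096 * s)" using s by simp
    thus ?thesis using \<kappa> by (cases \<kappa>) auto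
  qed
  define A where "A = (\<lambda>i. measure \<nu> {u \<in> D. level i \<le> (cmod (?f u))\<^sup>2})"
  define B where "B = (\<lambda>i. P (\<lambda>u. level i / 4 \<le> (cmod (?f u))\<^sup>2))"
  have level_bound: "(level i * A i - slack n i) / 2 - level i * (1 / (512 * s)) \<le> level i * B i" if i: "i < n" for i
  proof -
    define r where "r = sqrt (level i)"
    have r2: "r\<^sup>2 = level i" and r0: "0 \<le> r" by (auto simp: r_def level_def)
    have "(2::real) ^ i \<le> 2 ^ n" using i by (intro power_increasing) auto
    hence "level i \<le> 32 * s" unfolding level_def using s(3) by linarith
    hence "r \<le> sqrt (32 * s)" unfolding r_def by simp
    also have "\<dots> \<le> sqrt (256 * 256 * s)" using s by simp
    also have "\<dots> = 32 * (8 * sqrt s)" by (simp only: real_sqrt_mult real_sqrt_abs2) simp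
    finally have r32: "r \<le> 32 * (8 * sqrt s)" .
    have "\<exists>h\<in>PiE {..<k n i} (\<lambda>_. \<Lambda> \<times> units4).
       measure \<nu> {u \<in> D. r / 4 < cmod (?f u - dict_mean (8 * sqrt s) (k n i) h u)}
       + (\<Sum>l<m. of_bool (r / 4 < cmod (?f (t l) - dict_mean (8 * sqrt s) (k n i) h (t l)))) / real m
       \<le> 8 * exp (- (real (k n i) * (r / (4 * (8 * sqrt s)))\<^sup>2 / 64))"
      using s x(2) \<kappa>0 r32 t m r0
      by (intro maurey_approximation) (auto simp: k_def)
    then obtain h where h: "h \<in> PiE {..<k n i} (\<lambda>_. \<Lambda> \<times> units4)"
      and close: "measure \<nu> {u \<in> D. r / 4 < cmod (?f u - dict_mean (8 * sqrt s) (k n i) h u)}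
       + P (\<lambda>u. r / 4 < cmod (?f u - dict_mean (8 * sqrt s) (k n i) h u))
       \<le> 8 * exp (- (real (k n i) * (r / (4 * (8 * sqrt s)))\<^sup>2 / 64))"
      unfolding P_def by blast
    define far where "far = (\<lambda>u. r / 4 < cmod (?f u - dict_mean (8 * sqrt s) (k n i) h u))"
    define p where "p = measure \<nu> {u \<in> D. exceed s (k n i) i h u}"
    \<comment> \<open>\<open>k n i\<close> grows as the level shrinks, which makes the exponent
      independent of \<open>i\<close>. The choice of \<open>\<kappa>\<close> turns the Maurey bound
      into \<open>8 / (4096 * s) = 1 / (512 * s)\<close>.\<close>
    have "real (k n i) * (r / (4 * (8 * sqrt s)))\<^sup>2 / 64 = real \<kappa> * (2 ^ (n - i) * 2 ^ i) / (131072 * s)"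
      using s by (simp add: k_def power_divide power_mult_distrib r2 level_def)
    also have "(2::real) ^ (n - i) * 2 ^ i = 2 ^ n" using i by (simp flip: power_add)
    also have "real \<kappa> * 2 ^ n / (131072 * s) \<ge> real \<kappa> * (32 * s) / (131072 * s)"
      using s by (intro divide_right_mono mult_left_mono) auto
    also have "real \<kappa> * (32 * s) / (131072 * s) = real \<kappa> / 4096" using s by simp
    also have "real \<kappa> / 4096 \<ge> ln (4096 * s)" using \<kappa> by simp
    finally have "exp (- (real (k n i) * (r / (4 * (8 * sqrt s)))\<^sup>2 / 64)) \<le> exp (- ln (4096 * s))"
      by simp
    also have "\<dots> = 1 / (4096 * s)" using s by (simp add: exp_minus field_simps)
    finally have far: "measure \<nu> {u \<in> D. far u} + P far \<le> 1 / (512 * s)"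
      using close unfolding far_def by simp
    have [measurable]: "dict_mean (8 * sqrt s) (k n i) h \<in> borel_measurable \<nu>" "?f \<in> borel_measurable \<nu>"
      using measurable_dict_mean[OF h] measurable_expansion by auto
    have "A i \<le> measure \<nu> ({u \<in> D. exceed s (k n i) i h u} \<union> {u \<in> D. far u})"
      unfolding A_def
    proof (rule finite_measure_mono)
      show "{u \<in> D. exceed s (k n i) i h u} \<union> {u \<in> D. far u} \<in> sets \<nu>"
        unfolding far_def exceed_def space_eq[symmetric] by measurable
      show "{u \<in> D. level i \<le> (cmod (?f u))\<^sup>2} \<subseteq> {u \<in> D. exceed s (k n i) i h u} \<union> {u \<in> D. far u}"
      proof (intro subsetI, elim CollectE conjE)
        fix u assume u: "u \<in> D" "level i \<le> (cmod (?f u))\<^sup>2"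
        have "r \<le> cmod (?f u)" using u(2) unfolding r_def by (simp add: real_le_lsqrt)
        thus "u \<in> {u \<in> D. exceed s (k n i) i h u} \<union> {u \<in> D. far u}"
          using u(1) norm_triangle_sub[of "?f u" "dict_mean (8 * sqrt s) (k n i) h u"]
          by (auto simp: exceed_def far_def r_def[symmetric])
      qed
    qed
    also have "\<dots> \<le> p + measure \<nu> {u \<in> D. far u}"
      unfolding p_def by (rule measure_subadditive)
        (simp_all add: far_def exceed_def space_eq[symmetric] emeasure_finite)
    finally have A: "A i \<le> p + measure \<nu> {u \<in> D. far u}" .
    have Bi: "P (exceed s (k n i) i h) \<le> B i + P far"
      unfolding B_def
    proof (rule P_mono)
      fix u assume "exceed s (k n i) i h u"
      hence ge: "3 / 4 * r \<le> cmod (dict_mean (8 * sqrt s) (k n i) h u)"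
        by (simp add: exceed_def r_def)
      show "level i / 4 \<le> (cmod (?f u))\<^sup>2 \<or> far u"
      proof (rule disjCI)
        assume "\<not> far u"
        hence "r / 2 \<le> cmod (?f u)"
          using ge norm_triangle_sub[of "dict_mean (8 * sqrt s) (k n i) h u" "?f u"]
          by (simp add: far_def norm_minus_commute)
        hence "(r / 2)\<^sup>2 \<le> (cmod (?f u))\<^sup>2" using r0 by (intro power_mono) auto
        thus "level i / 4 \<le> (cmod (?f u))\<^sup>2" by (simp add: power_divide r2)
      qed
    qed
    have P0: "0 \<le> P Q" for Q by (simp add: P_def sum_nonneg)
    have "(level i * p - slack n i) / 2 \<le> level i * P (exceed s (k n i) i h)"
    \<comment> \<open>Below the slack the left-hand side is negative, so an exempt level costs no
      more than its slack.\<close>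
    proof (cases "slack n i \<le> level i * p")
      case True
      hence "p / 2 \<le> P (exceed s (k n i) i h)"
        using good h i m unfolding good_sample_def p_def P_def by (auto simp: field_simps)
      hence "level i * (p / 2) \<le> level i * P (exceed s (k n i) i h)"
        by (intro mult_left_mono) (auto simp: level_def)
      moreover have "0 \<le> slack n i" by (simp add: slack_def)
      ultimately show ?thesis by simp
    next
      case False
      moreover have "0 \<le> level i * P (exceed s (k n i) i h)" using P0 by (simp add: level_def)
      ultimately show ?thesis by simp
    qed
    moreover have "level i * A i \<le> level i * p + level i * measure \<nu> {u \<in> D. far u}"
      unfolding distrib_left[symmetric] using A by (intro mult_left_mono) (auto simp: level_def)
    moreover have "level i * P (exceed s (k n i) i h) \<le> level i * B i + level i * P far"
      unfolding distrib_left[symmetric] using Bi by (intro mult_left_mono) (auto simp: level_def)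
    moreover have "level i * measure \<nu> {u \<in> D. far u} + level i * P far \<le> level i * (1 / (512 * s))"
      unfolding distrib_left[symmetric] using far by (intro mult_left_mono) (auto simp: level_def)
    moreover have "0 \<le> level i * measure \<nu> {u \<in> D. far u}" by (simp add: level_def)
    ultimately show ?thesis by (simp add: diff_divide_distrib)
  qed
  have "1 / 2 \<le> (\<Sum>i<n. level i * A i)"
    unfolding A_def
  proof (rule second_moment_layers[OF x(1)])
    have "(weighted_l1 \<Lambda> \<omega> x)\<^sup>2 \<le> (4 * sqrt s)\<^sup>2"
      using x(2) weight_ge_1 by (intro power_mono) (force simp: weighted_l1_def intro!: sum_nonneg mult_nonneg_nonneg)+
    thus "(weighted_l1 \<Lambda> \<omega> x)\<^sup>2 \<le> 2 ^ n / 2" using s by (simp add: power_mult_distrib)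
  qed
  \<comment> \<open>Total cost of the Maurey exceptional sets: the levels add up to at most
    \<open>32 * s\<close>, hence the factor 512.\<close>
  moreover have "(\<Sum>i<n. level i) * (1 / (512 * s)) \<le> 1 / 16"
  proof -
    have "(\<Sum>i<n. level i) = (2 ^ n - 1) / 2"
      unfolding level_def sum_divide_distrib[symmetric] by (subst geometric_sum) simp_all
    also have "\<dots> \<le> 32 * s" using s by simp
    finally show ?thesis using s by (simp add: field_simps)
  qed
  moreover note sum_slack_le[OF n]
  moreover have "(\<Sum>i<n. (level i * A i - slack n i) / 2 - level i * (1 / (512 * s))) \<le> (\<Sum>i<n. level i * B i)"
    using level_bound by (intro sum_mono) auto
  hence "((\<Sum>i<n. level i * A i) - (\<Sum>i<n. slack n i)) / 2 - (\<Sum>i<n. level i) * (1 / (512 * s))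
      \<le> (\<Sum>i<n. level i * B i)"
    by (simp only: sum_subtractf sum_divide_distrib[symmetric] sum_distrib_right[symmetric])
  \<comment> \<open>Half of what remains of 1/2 after losing 1/16 to the slack, minus 1/16 for the
    exceptional sets, is 5/32.\<close>
  moreover have "1 / 8 \<le> b" if "1 / 2 \<le> a" "e \<le> 1 / 16" "c \<le> 1 / 16" "(a - c) / 2 - e \<le> b" for a b c e :: real
    using that by argo
  ultimately have "1 / 8 \<le> (\<Sum>i<n. level i * B i)" by blast
  \<comment> \<open>Exchanging the sums returns to single sample points, where a layer sum is at
    most 8 times the squared modulus; this turns 1/8 into 1/64.\<close>
  also have "\<dots> = (\<Sum>l<m. \<Sum>i<n. level i * of_bool (level i / 4 \<le> (cmod (?f (t l)))\<^sup>2)) / real m"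
    unfolding B_def P_def sum_distrib_left sum_divide_distrib times_divide_eq_right by (rule sum.swap)
  also have "\<dots> \<le> (\<Sum>l<m. 8 * (cmod (?f (t l)))\<^sup>2) / real m"
    using dyadic_layers_le[of "1 / 2"]
    by (intro divide_right_mono sum_mono) (simp_all add: level_def)
  finally show ?thesis using m by (simp add: sum_distrib_left[symmetric] field_simps)
qed

text \<open>A union bound over levels and tuples. Where \<open>good_sample\<close> demands
  something, the exceedance probability is at least \<open>slack n i / level i\<close>, which gives
  the exponent. The event is the complement of finitely many measurable bad sets.\<close>

lemma prob_good_sample:
  fixes k :: "nat \<Rightarrow> nat"
  shows "\<exists>E\<in>sets (\<Pi>\<^sub>M l\<in>{..<m}. \<nu>). (\<forall>t\<in>E. (\<forall>l<m. t l \<in> D) \<and> good_sample s n k m t) \<and>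
     1 - (\<Sum>i<n. (4 * real (card \<Lambda>)) ^ k i * exp (- (real m * (slack n i / level i) / 8)))
       \<le> measure (\<Pi>\<^sub>M l\<in>{..<m}. \<nu>) E"
proof -
  let ?P = "\<Pi>\<^sub>M l\<in>{..<m}. \<nu>"
  let ?H = "\<lambda>i. PiE {..<k i} (\<lambda>_. \<Lambda> \<times> units4)"
  interpret P: product_prob_space "\<lambda>_. \<nu>" "{..<m}" ..
  define p where "p = (\<lambda>i h. measure \<nu> {u \<in> D. exceed s (k i) i h u})"
  have fold_p: "measure \<nu> {u \<in> D. exceed s (k i) i h u} = p i h" for i h by (simp add: p_def)
  define Bad where "Bad = (\<lambda>i h. if slack n i \<le> level i * p i h
     then {t \<in> space ?P. (\<Sum>l<m. of_bool (exceed s (k i) i h (t l)) :: real) \<le> real m * p i h / 2} else {})"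
  have Bad: "Bad i h \<in> sets ?P" "measure ?P (Bad i h) \<le> exp (- (real m * (slack n i / level i) / 8))"
    if h: "h \<in> ?H i" for i h
  proof -
    let ?Y = "indicat_real {u \<in> D. exceed s (k i) i h u}"
    note meas = measurable_exceed[OF h, of s i]
    have Y: "?Y \<in> borel_measurable \<nu>" using meas by simp
    have EY: "expectation ?Y = p i h" using meas by (simp add: p_def)
    have eq: "{t \<in> space ?P. (\<Sum>l<m. ?Y (t l)) \<le> real m * p i h / 2}
      = {t \<in> space ?P. (\<Sum>l<m. of_bool (exceed s (k i) i h (t l)) :: real) \<le> real m * p i h / 2}"
      by (intro Collect_cong conj_cong refl arg_cong2[where f = "(\<le>)"] sum.cong)
        (auto simp: space_PiM space_eq indicator_def PiE_iff)
    let ?B = "{t \<in> space ?P. (\<Sum>l<m. of_bool (exceed s (k i) i h (t l)) :: real) \<le> real m * p i h / 2}"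
    have c: "?B \<in> sets ?P" "measure ?P ?B \<le> exp (- (real m * p i h / 8))"
      using chernoff_lower_tail[OF Y, of m, unfolded EY eq] by (simp_all only: indicator_pos_le indicator_le_1)
    show "Bad i h \<in> sets ?P" unfolding Bad_def using c(1) by (cases "slack n i \<le> level i * p i h") simp_all
    show "measure ?P (Bad i h) \<le> exp (- (real m * (slack n i / level i) / 8))"
    proof (cases "slack n i \<le> level i * p i h")
      case True
      have "slack n i / level i \<le> p i h" using True by (simp add: level_def field_simps)
      hence "exp (- (real m * p i h / 8)) \<le> exp (- (real m * (slack n i / level i) / 8))"
        by (intro iffD2[OF exp_le_cancel_iff] le_imp_neg_le divide_right_mono mult_left_mono) simp_all
      thus ?thesis unfolding Bad_def if_P[OF True] using c(2) by (rule order.trans[rotated])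
    qed (simp add: Bad_def)
  qed
  have finH: "finite (?H i)" for i using finite_index units4(1) by (intro finite_PiE) auto
  have cardH: "card (?H i) = (4 * card \<Lambda>) ^ k i" for i
    using finite_index by (simp add: card_PiE card_cartesian_product units4 mult.commute)
  define U where "U = (\<Union>i<n. \<Union>h\<in>?H i. Bad i h)"
  have inner: "(\<Union>h\<in>?H i. Bad i h) \<in> sets ?P" for i using Bad(1) finH by auto
  have U: "U \<in> sets ?P" unfolding U_def using inner by auto
  have "measure ?P U \<le> (\<Sum>i<n. measure ?P (\<Union>h\<in>?H i. Bad i h))"
    unfolding U_def using inner by (intro P.finite_measure_subadditive_finite) auto
  also have "\<dots> \<le> (\<Sum>i<n. \<Sum>h\<in>?H i. measure ?P (Bad i h))"
    using Bad(1) finH by (intro sum_mono P.finite_measure_subadditive_finite) auto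
  also have "\<dots> \<le> (\<Sum>i<n. \<Sum>h\<in>?H i. exp (- (real m * (slack n i / level i) / 8)))"
    using Bad(2) by (intro sum_mono) auto
  also have "\<dots> = (\<Sum>i<n. (4 * real (card \<Lambda>)) ^ k i * exp (- (real m * (slack n i / level i) / 8)))"
    by (simp add: cardH)
  finally have mU: "measure ?P U \<le> \<dots>" .
  show ?thesis
  proof (intro bexI conjI ballI allI impI)
    show "space ?P - U \<in> sets ?P" using U by auto
    show "1 - (\<Sum>i<n. (4 * real (card \<Lambda>)) ^ k i * exp (- (real m * (slack n i / level i) / 8)))
       \<le> measure ?P (space ?P - U)"
      using mU P.prob_compl[OF U] by simp
    fix t assume t: "t \<in> space ?P - U"
    show "t l \<in> D" if "l < m" for l using t that by (auto simp: space_PiM space_eq)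
    show "good_sample s n k m t"
      unfolding good_sample_def fold_p
    proof (intro allI impI ballI)
      fix i h assume ih: "i < n" "h \<in> ?H i" and slack: "slack n i \<le> level i * p i h"
      have "t \<notin> Bad i h" "t \<in> space ?P" using t ih unfolding U_def by blast+
      thus "real m * p i h / 2 \<le> (\<Sum>l<m. of_bool (exceed s (k i) i h (t l)))"
        unfolding Bad_def if_P[OF slack] by simp
    qed
  qed
qed

section \<open>From unit vectors to the whole cone\<close>

lemma expansion_scale: "expansion \<Lambda> \<psi> (\<lambda>j. c * x j) u = c * expansion \<Lambda> \<psi> x u"
  by (simp add: expansion_def sum_distrib_left mult_ac)

lemma weighted_l1_scale: "weighted_l1 \<Lambda> \<omega> (\<lambda>j. c * x j) = cmod c * weighted_l1 \<Lambda> \<omega> x"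
  by (simp add: weighted_l1_def sum_distrib_left norm_mult mult_ac)

text \<open>Both the cone and the bound are homogeneous, so vectors of unit l2 norm suffice. Two
  indices make \<open>ln (card \<Lambda>)\<close> exceed 1/2, on which the failure estimate
  relies.\<close>

lemma restricted_lower_bound_card_ge_2:
  assumes s: "2 \<le> s" and N: "2 \<le> card \<Lambda>" and \<gamma>: "0 < \<gamma>" "\<gamma> < 1"
    and m: "10 ^ 11 * s * max ((ln s) ^ 3 * ln (real (card \<Lambda>))) (ln (1 / \<gamma>)) \<le> real m"
  shows "\<exists>E\<in>sets (\<Pi>\<^sub>M l\<in>{..<m}. \<nu>). 1 - \<gamma> < measure (\<Pi>\<^sub>M l\<in>{..<m}. \<nu>) E \<and>
    (\<forall>t\<in>E. \<forall>x. weighted_l1 \<Lambda> \<omega> x \<le> 4 * sqrt s * L2_set (\<lambda>j. cmod (x j)) \<Lambda> \<longrightarrow>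
       real m / 64 * (\<Sum>j\<in>\<Lambda>. (cmod (x j))\<^sup>2) \<le> (\<Sum>l<m. (cmod (expansion \<Lambda> \<psi> x (t l)))\<^sup>2))"
proof -
  obtain n :: nat where n: "32 * s \<le> 2 ^ n" "2 ^ n \<le> 64 * s" using ex_dyadic_scale[of s] s by auto
  define \<kappa> where "\<kappa> = nat \<lceil>4096 * ln (4096 * s)\<rceil>"
  have "0 \<le> ln (4096 * s)" using s by simp
  hence \<kappa>: "4096 * ln (4096 * s) \<le> real \<kappa>" "real \<kappa> \<le> 4096 * ln (4096 * s) + 1"
    unfolding \<kappa>_def by linarith+
  have m0: "0 < m"
  proof -
    have "0 < ln (1 / \<gamma>)" using \<gamma> by simp
    hence "0 < 10 ^ 11 * s * max ((ln s) ^ 3 * ln (real (card \<Lambda>))) (ln (1 / \<gamma>))"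
      using s by (intro mult_pos_pos) auto
    thus ?thesis using m by (cases m) auto
  qed
  obtain E where E: "E \<in> sets (\<Pi>\<^sub>M l\<in>{..<m}. \<nu>)"
    "\<And>t. t \<in> E \<Longrightarrow> (\<forall>l<m. t l \<in> D) \<and> good_sample s n (\<lambda>i. \<kappa> * 2 ^ (n - i)) m t"
    "1 - (\<Sum>i<n. (4 * real (card \<Lambda>)) ^ (\<kappa> * 2 ^ (n - i)) * exp (- (real m * (slack n i / level i) / 8)))
       \<le> measure (\<Pi>\<^sub>M l\<in>{..<m}. \<nu>) E"
    using prob_good_sample[of m s n "\<lambda>i. \<kappa> * 2 ^ (n - i)"] by blast
  show ?thesis
  proof (intro bexI[OF _ E(1)] conjI ballI allI impI)
    show "1 - \<gamma> < measure (\<Pi>\<^sub>M l\<in>{..<m}. \<nu>) E"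
      using failure_sum_less[OF s n \<kappa>(2) N \<gamma> m] E(3) by simp
    fix t x assume t: "t \<in> E" and x: "weighted_l1 \<Lambda> \<omega> x \<le> 4 * sqrt s * L2_set (\<lambda>j. cmod (x j)) \<Lambda>"
    define V where "V = L2_set (\<lambda>j. cmod (x j)) \<Lambda>"
    have V2: "V\<^sup>2 = (\<Sum>j\<in>\<Lambda>. (cmod (x j))\<^sup>2)" by (simp add: V_def L2_set_def sum_nonneg)
    show "real m / 64 * (\<Sum>j\<in>\<Lambda>. (cmod (x j))\<^sup>2) \<le> (\<Sum>l<m. (cmod (expansion \<Lambda> \<psi> x (t l)))\<^sup>2)"
    proof (cases "V = 0")
      case True
      thus ?thesis unfolding V2[symmetric] by (simp add: sum_nonneg)
    next
      case False
      hence V: "0 < V" unfolding V_def using L2_set_nonneg by (metis less_le)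
      define z where "z = (\<lambda>j. of_real (inverse V) * x j)"
      have "real m / 64 \<le> (\<Sum>l<m. (cmod (expansion \<Lambda> \<psi> z (t l)))\<^sup>2)"
      proof (rule good_sample_lower_bound[OF _ n \<kappa>(1)])
        have "(\<Sum>j\<in>\<Lambda>. (cmod (z j))\<^sup>2) = inverse V ^ 2 * V\<^sup>2"
          unfolding V2 z_def norm_mult norm_of_real power_mult_distrib power2_abs sum_distrib_left ..
        thus "(\<Sum>j\<in>\<Lambda>. (cmod (z j))\<^sup>2) = 1" using V by (simp add: field_simps)
        show "weighted_l1 \<Lambda> \<omega> z \<le> 4 * sqrt s"
          using x V unfolding z_def weighted_l1_scale norm_of_real V_def[symmetric] by (simp add: field_simps)
      qed (use s m0 E(2)[OF t] in auto)
      also have "\<dots> = inverse V ^ 2 * (\<Sum>l<m. (cmod (expansion \<Lambda> \<psi> x (t l)))\<^sup>2)"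
        unfolding z_def expansion_scale norm_mult norm_of_real power_mult_distrib power2_abs sum_distrib_left ..
      finally have "real m / 64 * V\<^sup>2 \<le> inverse V ^ 2 * (\<Sum>l<m. (cmod (expansion \<Lambda> \<psi> x (t l)))\<^sup>2) * V\<^sup>2"
        by (rule mult_right_mono) simp
      also have "\<dots> = (inverse V * V)\<^sup>2 * (\<Sum>l<m. (cmod (expansion \<Lambda> \<psi> x (t l)))\<^sup>2)"
        unfolding power_mult_distrib by (simp only: mult_ac)
      also have "inverse V * V = 1" using V by simp
      finally show ?thesis unfolding V2[symmetric] by simp
    qed
  qed
qed

text \<open>With one index \<open>ln (card \<Lambda>)\<close> vanishes and \<open>m\<close> is
  controlled only through \<open>ln (1 / \<gamma>)\<close>. All expansions are multiples of one
  function, so a single Chernoff bound for its squared modulus over \<open>(\<omega> j)^2\<close>,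
  of mean \<open>1 / (\<omega> j)^2\<close>, replaces the union bound.\<close>

lemma restricted_lower_bound_card_1:
  assumes s: "\<And>j. j \<in> \<Lambda> \<Longrightarrow> 2 * (\<omega> j)\<^sup>2 \<le> s" and N: "card \<Lambda> = 1" and \<gamma>: "0 < \<gamma>" "\<gamma> < 1"
    and m: "10 ^ 11 * s * ln (1 / \<gamma>) \<le> real m"
  shows "\<exists>E\<in>sets (\<Pi>\<^sub>M l\<in>{..<m}. \<nu>). 1 - \<gamma> < measure (\<Pi>\<^sub>M l\<in>{..<m}. \<nu>) E \<and>
    (\<forall>t\<in>E. \<forall>x. real m / 64 * (\<Sum>j\<in>\<Lambda>. (cmod (x j))\<^sup>2) \<le> (\<Sum>l<m. (cmod (expansion \<Lambda> \<psi> x (t l)))\<^sup>2))"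
proof -
  let ?P = "\<Pi>\<^sub>M l\<in>{..<m}. \<nu>"
  interpret P: product_prob_space "\<lambda>_. \<nu>" "{..<m}" ..
  obtain j where \<Lambda>: "\<Lambda> = {j}" using N by (auto simp: card_1_singleton_iff)
  have \<omega>: "1 \<le> \<omega> j" and s': "2 * (\<omega> j)\<^sup>2 \<le> s" using weight_ge_1 s \<Lambda> by auto
  have \<omega>2: "1 \<le> (\<omega> j)\<^sup>2" using \<omega> by (simp add: one_le_power)
  define Y where "Y = (\<lambda>u. (cmod (\<psi> j u))\<^sup>2 / (\<omega> j)\<^sup>2)"
  have [measurable]: "\<psi> j \<in> borel_measurable \<nu>" using measurable_\<psi> \<Lambda> by simp
  have Y: "Y \<in> borel_measurable \<nu>" "0 \<le> Y u" for u unfolding Y_def by auto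
  have Y1: "Y u \<le> 1" if "u \<in> space \<nu>" for u
  proof -
    have "(cmod (\<psi> j u))\<^sup>2 \<le> (\<omega> j)\<^sup>2" using cmod_\<psi>_le[of j u] that \<Lambda> space_eq by (intro power_mono) auto
    moreover have "0 < (\<omega> j)\<^sup>2" using \<omega>2 by linarith
    ultimately show ?thesis by (simp add: Y_def pos_divide_le_eq)
  qed
  have "expectation (\<lambda>u. (cmod (\<psi> j u))\<^sup>2) = 1"
    using has_bochner_integral_integral_eq[OF parseval[of "\<lambda>_. 1"]] by (simp add: expansion_def \<Lambda>)
  hence EY: "expectation Y = 1 / (\<omega> j)\<^sup>2" by (simp add: Y_def)
  define B where "B = {t \<in> space ?P. (\<Sum>l<m. Y (t l)) \<le> real m * (1 / (\<omega> j)\<^sup>2) / 2}"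
  have B: "B \<in> sets ?P" "measure ?P B \<le> exp (- (real m * (1 / (\<omega> j)\<^sup>2) / 8))"
    unfolding B_def using chernoff_lower_tail[OF Y Y1, of m, unfolded EY] by auto
  have "ln (1 / \<gamma>) < real m * (1 / (\<omega> j)\<^sup>2) / 8"
  proof -
    have l: "0 < ln (1 / \<gamma>)" using \<gamma> by simp
    have "8 * (\<omega> j)\<^sup>2 * ln (1 / \<gamma>) \<le> 4 * s * ln (1 / \<gamma>)" using s' l by (intro mult_right_mono) auto
    also have "\<dots> < 10 ^ 11 * s * ln (1 / \<gamma>)" using l s' \<omega>2 by (intro mult_strict_right_mono) auto
    also have "\<dots> \<le> real m" by fact
    finally have "8 * (\<omega> j)\<^sup>2 * ln (1 / \<gamma>) < real m" .
    moreover have "0 < (\<omega> j)\<^sup>2" using \<omega>2 by linarith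
    ultimately show ?thesis by (simp add: pos_less_divide_eq mult_ac)
  qed
  hence "exp (- (real m * (1 / (\<omega> j)\<^sup>2) / 8)) < exp (- ln (1 / \<gamma>))" by simp
  also have "\<dots> = \<gamma>" using \<gamma> by (simp add: exp_minus)
  finally have mB: "measure ?P B < \<gamma>" using B(2) by simp
  show ?thesis
  proof (intro bexI[of _ "space ?P - B"] conjI ballI allI)
    show "1 - \<gamma> < measure ?P (space ?P - B)" using P.prob_compl[OF B(1)] mB by simp
    show "space ?P - B \<in> sets ?P" using B(1) by auto
    fix t x assume t: "t \<in> space ?P - B"
    hence "\<not> (\<Sum>l<m. Y (t l)) \<le> real m * (1 / (\<omega> j)\<^sup>2) / 2" unfolding B_def by blast
    hence "real m * (1 / (\<omega> j)\<^sup>2) / 2 \<le> (\<Sum>l<m. Y (t l))" by linarith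
    also have "\<dots> = (\<Sum>l<m. (cmod (\<psi> j (t l)))\<^sup>2) / (\<omega> j)\<^sup>2" by (simp add: Y_def sum_divide_distrib)
    finally have "real m / 2 \<le> (\<Sum>l<m. (cmod (\<psi> j (t l)))\<^sup>2)" using \<omega> by (auto simp: field_simps)
    hence "(cmod (x j))\<^sup>2 * (real m / 64) \<le> (cmod (x j))\<^sup>2 * (\<Sum>l<m. (cmod (\<psi> j (t l)))\<^sup>2)"
      by (intro mult_left_mono) auto
    thus "real m / 64 * (\<Sum>j\<in>\<Lambda>. (cmod (x j))\<^sup>2) \<le> (\<Sum>l<m. (cmod (expansion \<Lambda> \<psi> x (t l)))\<^sup>2)"
      by (simp add: \<Lambda> expansion_def norm_mult power_mult_distrib sum_distrib_left mult.commute)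
  qed
qed

lemma restricted_lower_bound:
  assumes s: "2 * (MAX j\<in>\<Lambda>. \<bar>\<omega> j\<bar>\<^sup>2) \<le> s" and \<gamma>: "0 < \<gamma>" "\<gamma> < 1"
    and m: "10 ^ 11 * s * max ((ln s) ^ 3 * ln (real (card \<Lambda>))) (ln (1 / \<gamma>)) \<le> real m"
  shows "\<exists>E\<in>sets (\<Pi>\<^sub>M l\<in>{..<m}. \<nu>). 1 - \<gamma> < measure (\<Pi>\<^sub>M l\<in>{..<m}. \<nu>) E \<and>
    (\<forall>t\<in>E. \<forall>x. weighted_l1 \<Lambda> \<omega> x \<le> 4 * sqrt s * L2_set (\<lambda>j. cmod (x j)) \<Lambda> \<longrightarrow>
       real m / 64 * (\<Sum>j\<in>\<Lambda>. (cmod (x j))\<^sup>2) \<le> (\<Sum>l<m. (cmod (expansion \<Lambda> \<psi> x (t l)))\<^sup>2))"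
    and "2 \<le> s" and "0 < m"
proof -
  have s\<omega>: "2 * (\<omega> j)\<^sup>2 \<le> s" if "j \<in> \<Lambda>" for j
  proof -
    have "(\<omega> j)\<^sup>2 \<le> (MAX j\<in>\<Lambda>. (\<omega> j)\<^sup>2)" using finite_index that by (intro Max_ge) auto
    thus ?thesis using s unfolding power2_abs by linarith
  qed
  obtain j where "j \<in> \<Lambda>" using nonempty_index by blast
  thus s2: "2 \<le> s" using s\<omega>[of j] one_le_power[OF weight_ge_1[of j], of 2] by simp
  have \<gamma>0: "0 < ln (1 / \<gamma>)" using \<gamma> by simp
  have m\<gamma>: "10 ^ 11 * s * ln (1 / \<gamma>) \<le> real m"
    using s2 by (intro order.trans[OF mult_left_mono m]) auto
  moreover have "0 < 10 ^ 11 * s * ln (1 / \<gamma>)" using s2 \<gamma>0 by simp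
  ultimately show "0 < m" by (cases m) auto
  show "\<exists>E\<in>sets (\<Pi>\<^sub>M l\<in>{..<m}. \<nu>). 1 - \<gamma> < measure (\<Pi>\<^sub>M l\<in>{..<m}. \<nu>) E \<and>
    (\<forall>t\<in>E. \<forall>x. weighted_l1 \<Lambda> \<omega> x \<le> 4 * sqrt s * L2_set (\<lambda>j. cmod (x j)) \<Lambda> \<longrightarrow>
       real m / 64 * (\<Sum>j\<in>\<Lambda>. (cmod (x j))\<^sup>2) \<le> (\<Sum>l<m. (cmod (expansion \<Lambda> \<psi> x (t l)))\<^sup>2))"
  proof (cases "2 \<le> card \<Lambda>")
    case True
    thus ?thesis by (rule restricted_lower_bound_card_ge_2[OF s2 _ \<gamma> m])
  next
    case False
    moreover have "card \<Lambda> \<noteq> 0" using finite_index nonempty_index by simp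
    ultimately have "card \<Lambda> = 1" by simp
    thus ?thesis using restricted_lower_bound_card_1[OF s\<omega> _ \<gamma> m\<gamma>] by blast
  qed
qed

section \<open>Recovery by weighted minimization\<close>

text \<open>The reverse triangle inequality is used on the support of \<open>z\<close> and the
  triangle inequality off it, where \<open>x\<close> equals \<open>x - z\<close>; \<open>le\<close>
  then disposes of the norms of \<open>x\<close> and \<open>x'\<close>. Cauchy-Schwarz on the
  support uses that its squared weights sum to at most \<open>s\<close>.\<close>

lemma weighted_l1_minimizer_cone:
  assumes z: "weighted_l0 \<Lambda> \<omega> z \<le> s"
    and le: "weighted_l1 \<Lambda> \<omega> x' \<le> weighted_l1 \<Lambda> \<omega> x"
  shows "weighted_l1 \<Lambda> \<omega> (\<lambda>j. x j - x' j)
     \<le> 2 * sqrt s * L2_set (\<lambda>j. cmod (x j - x' j)) \<Lambda> + 2 * weighted_l1 \<Lambda> \<omega> (\<lambda>j. x j - z j)"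
proof -
  define S where "S = {j \<in> \<Lambda>. z j \<noteq> 0}"
  have S: "S \<subseteq> \<Lambda>" "finite S" using finite_index by (auto simp: S_def)
  have "weighted_l1 \<Lambda> \<omega> (\<lambda>j. x j - x' j)
     \<le> (\<Sum>j\<in>\<Lambda>. \<omega> j * cmod (x' j) - \<omega> j * cmod (x j) + 2 * (\<omega> j * cmod (x j - z j))
          + 2 * (if j \<in> S then \<omega> j * cmod (x j - x' j) else 0))"
    unfolding weighted_l1_def
  proof (intro sum_mono)
    fix j assume j: "j \<in> \<Lambda>"
    have \<omega>: "0 \<le> \<omega> j" using weight_ge_1[OF j] by simp
    have "cmod (x j - x' j) \<le> cmod (x' j) - cmod (x j) + 2 * cmod (x j - z j)
       + 2 * (if j \<in> S then cmod (x j - x' j) else 0)"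
    proof (cases "z j = 0")
      case True
      hence "j \<notin> S" by (simp add: S_def)
      thus ?thesis using norm_triangle_ineq4[of "x j" "x' j"] True by simp
    next
      case False
      hence "j \<in> S" using j by (simp add: S_def)
      thus ?thesis using norm_triangle_ineq2[of "x j" "x' j"] norm_ge_zero[of "x j - z j"]
        unfolding if_P[OF \<open>j \<in> S\<close>] by linarith
    qed
    from mult_left_mono[OF this \<omega>]
    show "\<omega> j * cmod (x j - x' j) \<le> \<omega> j * cmod (x' j) - \<omega> j * cmod (x j) + 2 * (\<omega> j * cmod (x j - z j))
          + 2 * (if j \<in> S then \<omega> j * cmod (x j - x' j) else 0)"
      by (simp add: algebra_simps split: if_splits)
  qed
  also have "\<dots> = weighted_l1 \<Lambda> \<omega> x' - weighted_l1 \<Lambda> \<omega> x + 2 * weighted_l1 \<Lambda> \<omega> (\<lambda>j. x j - z j)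
      + 2 * (\<Sum>j\<in>S. \<omega> j * cmod (x j - x' j))"
  proof -
    have "(\<Sum>j\<in>\<Lambda>. if j \<in> S then \<omega> j * cmod (x j - x' j) else 0) = (\<Sum>j\<in>S. \<omega> j * cmod (x j - x' j))"
      using S by (simp add: sum.inter_restrict[OF finite_index, symmetric] Int_absorb1)
    thus ?thesis by (simp add: weighted_l1_def sum.distrib sum_subtractf flip: sum_distrib_left)
  qed
  also have "(\<Sum>j\<in>S. \<omega> j * cmod (x j - x' j)) \<le> sqrt s * L2_set (\<lambda>j. cmod (x j - x' j)) \<Lambda>"
  proof -
    have "(\<Sum>j\<in>S. \<omega> j * cmod (x j - x' j)) \<le> (\<Sum>j\<in>S. \<bar>\<omega> j\<bar> * \<bar>cmod (x j - x' j)\<bar>)"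
      by (intro sum_mono) (simp add: mult_right_mono)
    also have "\<dots> \<le> L2_set \<omega> S * L2_set (\<lambda>j. cmod (x j - x' j)) S"
      by (rule L2_set_mult_ineq)
    also have "\<dots> \<le> sqrt s * L2_set (\<lambda>j. cmod (x j - x' j)) \<Lambda>"
    proof (intro mult_mono)
      show "L2_set \<omega> S \<le> sqrt s" using z by (simp add: L2_set_def weighted_l0_def S_def)
      show "L2_set (\<lambda>j. cmod (x j - x' j)) S \<le> L2_set (\<lambda>j. cmod (x j - x' j)) \<Lambda>"
        unfolding L2_set_def using S finite_index by (intro real_sqrt_le_mono sum_mono2) auto
      have "0 \<le> weighted_l0 \<Lambda> \<omega> z" by (simp add: weighted_l0_def sum_nonneg)
      thus "0 \<le> sqrt s" using z by simp
    qed (rule L2_set_nonneg)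
    finally show ?thesis .
  qed
  finally show ?thesis using le by simp
qed

text \<open>The noise bound makes the true \<open>x\<close> feasible, which gives both the norm
  comparison and the tube bound \<open>2 * \<eta>\<close>. The estimates are proved for every
  competitor \<open>z\<close> and pass to the infimum only at the end, so that no best approximation
  has to be exhibited.\<close>

lemma weighted_l1_recovery:
  assumes s: "0 < s" and m: "0 < m" and \<eta>: "l2_norm m \<xi> \<le> \<eta>"
    and lower: "\<And>v. weighted_l1 \<Lambda> \<omega> v \<le> 4 * sqrt s * L2_set (\<lambda>j. cmod (v j)) \<Lambda> \<Longrightarrow>
       real m / 64 * (\<Sum>j\<in>\<Lambda>. (cmod (v j))\<^sup>2) \<le> (\<Sum>l<m. (cmod (expansion \<Lambda> \<psi> v (t l)))\<^sup>2)"
    and y: "\<And>l. l < m \<Longrightarrow> y l = expansion \<Lambda> \<psi> x (t l) + \<xi> l"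
    and sol: "is_weighted_l1_solution m \<Lambda> \<omega> (sampling_matrix \<psi> t) y \<eta> x'"
  shows "weighted_l1 \<Lambda> \<omega> (\<lambda>j. x j - x' j) \<le> 4 * best_approx_error \<Lambda> \<omega> s x + 64 * \<eta> * sqrt (s / m)"
    "L2_set (\<lambda>j. cmod (x j - x' j)) \<Lambda> \<le> best_approx_error \<Lambda> \<omega> s x / sqrt s + 16 * \<eta> * sqrt (1 / m)"
proof -
  define v where "v = (\<lambda>j. x j - x' j)"
  define V where "V = L2_set (\<lambda>j. cmod (v j)) \<Lambda>"
  define W where "W = weighted_l1 \<Lambda> \<omega> v"
  have V0: "0 \<le> V" by (simp add: V_def)
  have \<eta>0: "0 \<le> \<eta>" using \<eta> by (simp add: l2_norm_def order.trans[OF L2_set_nonneg])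
  have mv: "mat_vec \<Lambda> (sampling_matrix \<psi> t) z l = expansion \<Lambda> \<psi> z (t l)" for z l
    by (simp add: mat_vec_def sampling_matrix_def expansion_def mult.commute)
  have feas': "L2_set (\<lambda>l. cmod (expansion \<Lambda> \<psi> x' (t l) - y l)) {..<m} \<le> \<eta>"
    using sol by (simp add: is_weighted_l1_solution_def is_arg_min_def l2_norm_def mv)
  have feas: "L2_set (\<lambda>l. cmod (expansion \<Lambda> \<psi> x (t l) - y l)) {..<m} \<le> \<eta>"
  proof -
    have "L2_set (\<lambda>l. cmod (expansion \<Lambda> \<psi> x (t l) - y l)) {..<m} = L2_set (\<lambda>l. cmod (\<xi> l)) {..<m}"
      by (intro L2_set_cong) (simp_all add: y flip: diff_diff_eq)
    thus ?thesis using \<eta> by (simp add: l2_norm_def)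
  qed
  have le: "weighted_l1 \<Lambda> \<omega> x' \<le> weighted_l1 \<Lambda> \<omega> x"
    using sol feas by (auto simp: is_weighted_l1_solution_def is_arg_min_def l2_norm_def mv)
  have "L2_set (\<lambda>l. cmod (expansion \<Lambda> \<psi> v (t l))) {..<m}
     \<le> L2_set (\<lambda>l. cmod (expansion \<Lambda> \<psi> x (t l) - y l) + cmod (expansion \<Lambda> \<psi> x' (t l) - y l)) {..<m}"
  proof (rule L2_set_mono)
    fix l
    have "expansion \<Lambda> \<psi> v (t l) = (expansion \<Lambda> \<psi> x (t l) - y l) - (expansion \<Lambda> \<psi> x' (t l) - y l)"
      by (simp add: expansion_def v_def left_diff_distrib sum_subtractf)
    thus "cmod (expansion \<Lambda> \<psi> v (t l)) \<le> cmod (expansion \<Lambda> \<psi> x (t l) - y l) + cmod (expansion \<Lambda> \<psi> x' (t l) - y l)"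
      by (simp only: norm_triangle_ineq4)
  qed simp
  also have "\<dots> \<le> \<eta> + \<eta>" by (intro order.trans[OF L2_set_triangle_ineq] add_mono feas feas')
  finally have tube: "L2_set (\<lambda>l. cmod (expansion \<Lambda> \<psi> v (t l))) {..<m} \<le> 2 * \<eta>" by simp
  have V_le: "V \<le> 16 * \<eta> * sqrt (1 / m)" if "W \<le> 4 * sqrt s * V"
  proof -
    have "real m / 64 * V\<^sup>2 \<le> (\<Sum>l<m. (cmod (expansion \<Lambda> \<psi> v (t l)))\<^sup>2)"
      using lower[of v] that by (simp add: V_def W_def L2_set_def sum_nonneg)
    hence "sqrt (real m / 64 * V\<^sup>2) \<le> 2 * \<eta>"
      using tube unfolding L2_set_def by (meson order.trans real_sqrt_le_mono)
    moreover have "sqrt 64 = (8 :: real)" by (rule real_sqrt_unique) auto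
    ultimately have "sqrt (real m) * V \<le> 16 * \<eta>"
      using V0 by (simp add: real_sqrt_mult real_sqrt_divide)
    thus ?thesis using m by (simp add: real_sqrt_divide field_simps)
  qed
  have bounds: "W \<le> 4 * \<sigma> + 64 * \<eta> * sqrt (s / m)" "V \<le> \<sigma> / sqrt s + 16 * \<eta> * sqrt (1 / m)"
    if z: "weighted_l0 \<Lambda> \<omega> z \<le> s" and \<sigma>: "\<sigma> = weighted_l1 \<Lambda> \<omega> (\<lambda>j. x j - z j)" for z \<sigma>
  proof -
    have \<sigma>0: "0 \<le> \<sigma>" unfolding \<sigma> weighted_l1_def
      using weight_ge_1 by (intro sum_nonneg mult_nonneg_nonneg) force+
    have W: "W \<le> 2 * sqrt s * V + 2 * \<sigma>"
      using weighted_l1_minimizer_cone[OF z le] by (simp add: W_def V_def v_def \<sigma>)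
    have "W \<le> 4 * \<sigma> + 64 * \<eta> * sqrt (s / m) \<and> V \<le> \<sigma> / sqrt s + 16 * \<eta> * sqrt (1 / m)"
    \<comment> \<open>The threshold balances the two terms bounding \<open>W\<close>, so each case
      keeps only one of them, doubled.\<close>
    proof (cases "\<sigma> \<le> sqrt s * V")
      case True
      hence W': "W \<le> 4 * sqrt s * V" using W by simp
      note V = V_le[OF W']
      have "4 * sqrt s * V \<le> 4 * sqrt s * (16 * \<eta> * sqrt (1 / m))"
        using V s by (intro mult_left_mono) auto
      also have "\<dots> = 64 * \<eta> * sqrt (s / m)" by (simp add: real_sqrt_divide)
      finally have "W \<le> 64 * \<eta> * sqrt (s / m)" using W' by linarith
      thus ?thesis using V \<sigma>0 s by (intro conjI add_increasing) auto
    next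
      case False
      hence "V \<le> \<sigma> / sqrt s" using s by (simp add: field_simps)
      moreover have "W \<le> 4 * \<sigma>" using W False by simp
      ultimately show ?thesis using \<eta>0 s by (intro conjI add_increasing2) auto
    qed
    thus "W \<le> 4 * \<sigma> + 64 * \<eta> * sqrt (s / m)" "V \<le> \<sigma> / sqrt s + 16 * \<eta> * sqrt (1 / m)" by auto
  qed
  have ne: "{z. weighted_l0 \<Lambda> \<omega> z \<le> s} \<noteq> {}"
    using s by (auto simp: weighted_l0_def intro!: exI[of _ "\<lambda>_. 0"])
  \<comment> \<open>Solving for the approximation error leaves a left-hand side free of
    \<open>z\<close>, hence a lower bound for the infimum.\<close>
  have "(W - 64 * \<eta> * sqrt (s / m)) / 4 \<le> best_approx_error \<Lambda> \<omega> s x"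
    unfolding best_approx_error_def using bounds(1) by (intro cINF_greatest ne) (auto simp: field_simps)
  thus "weighted_l1 \<Lambda> \<omega> (\<lambda>j. x j - x' j) \<le> 4 * best_approx_error \<Lambda> \<omega> s x + 64 * \<eta> * sqrt (s / m)"
    by (simp add: W_def v_def)
  have "(V - 16 * \<eta> * sqrt (1 / m)) * sqrt s \<le> best_approx_error \<Lambda> \<omega> s x"
    unfolding best_approx_error_def
  proof (intro cINF_greatest ne)
    fix z assume "z \<in> {z. weighted_l0 \<Lambda> \<omega> z \<le> s}"
    hence "V - 16 * \<eta> * sqrt (1 / m) \<le> weighted_l1 \<Lambda> \<omega> (\<lambda>j. x j - z j) / sqrt s"
      using bounds(2)[OF _ refl, of z] by simp
    thus "(V - 16 * \<eta> * sqrt (1 / m)) * sqrt s \<le> weighted_l1 \<Lambda> \<omega> (\<lambda>j. x j - z j)"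
      using s by (simp add: pos_le_divide_eq)
  qed
  hence "V - 16 * \<eta> * sqrt (1 / m) \<le> best_approx_error \<Lambda> \<omega> s x / sqrt s"
    using s by (simp add: pos_le_divide_eq)
  thus "L2_set (\<lambda>j. cmod (x j - x' j)) \<Lambda> \<le> best_approx_error \<Lambda> \<omega> s x / sqrt s + 16 * \<eta> * sqrt (1 / m)"
    by (simp add: V_def v_def)
qed

section \<open>From coefficients to functions, and the final estimate\<close>

lemma L2_norm_expansion: "L2_norm \<nu> (expansion \<Lambda> \<psi> x) = L2_set (\<lambda>j. cmod (x j)) \<Lambda>"
  using has_bochner_integral_integral_eq[OF parseval[of x]] by (simp add: L2_norm_def L2_set_def)

lemma sup_norm_expansion_le: "sup_norm D (expansion \<Lambda> \<psi> x) \<le> ereal (weighted_l1 \<Lambda> \<omega> x)"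
  unfolding sup_norm_def using cmod_expansion_le by (intro SUP_least) simp

end

theorem theorem6p1:
  "\<exists>c0 c1 d1 c2 d2 :: real. c0 > 0 \<and> c1 > 0 \<and> d1 > 0 \<and> c2 > 0 \<and> d2 > 0 \<and>
    (\<forall>(d :: nat) (D :: (nat \<Rightarrow> real) set) (\<nu> :: (nat \<Rightarrow> real) measure) (\<Lambda> :: nat set)
      (\<psi> :: nat \<Rightarrow> (nat \<Rightarrow> real) \<Rightarrow> complex) (\<omega> :: nat \<Rightarrow> real) (s :: real) (\<gamma> :: real) (m :: nat).
      bounded_domain d D \<longrightarrow> finite \<Lambda> \<longrightarrow> \<Lambda> \<noteq> {} \<longrightarrow>
      orthonormal_system D \<nu> \<Lambda> \<psi> \<longrightarrow>
      (\<forall>j\<in>\<Lambda>. \<omega> j \<ge> 1 \<and> ereal (\<omega> j) \<ge> sup_norm D (\<psi> j)) \<longrightarrow>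
      s \<ge> 2 * (MAX j\<in>\<Lambda>. \<bar>\<omega> j\<bar>\<^sup>2) \<longrightarrow>
      0 < \<gamma> \<longrightarrow> \<gamma> < 1 \<longrightarrow>
      real m \<ge> c0 * s * max ((ln s) ^ 3 * ln (real (card \<Lambda>))) (ln (1 / \<gamma>)) \<longrightarrow>
      (\<exists>E \<in> sets (\<Pi>\<^sub>M l\<in>{..<m}. \<nu>).
         measure (\<Pi>\<^sub>M l\<in>{..<m}. \<nu>) E > 1 - \<gamma> \<and>
         (\<forall>t\<in>E. \<forall>(x :: nat \<Rightarrow> complex) (f :: (nat \<Rightarrow> real) \<Rightarrow> complex)
             (\<xi> :: nat \<Rightarrow> complex) (y :: nat \<Rightarrow> complex) (\<eta> :: real)
             (x' :: nat \<Rightarrow> complex) (f' :: (nat \<Rightarrow> real) \<Rightarrow> complex).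
            f = expansion \<Lambda> \<psi> x \<longrightarrow>
            (\<forall>l<m. y l = f (t l) + \<xi> l) \<longrightarrow>
            l2_norm m \<xi> \<le> \<eta> \<longrightarrow>
            is_weighted_l1_solution m \<Lambda> \<omega> (sampling_matrix \<psi> t) y \<eta> x' \<longrightarrow>
            f' = expansion \<Lambda> \<psi> x' \<longrightarrow>
              sup_norm D (\<lambda>u. f u - f' u) \<le> ereal (weighted_l1 \<Lambda> \<omega> (\<lambda>j. x j - x' j)) \<and>
              weighted_l1 \<Lambda> \<omega> (\<lambda>j. x j - x' j)
                \<le> c1 * best_approx_error \<Lambda> \<omega> s x + d1 * \<eta> * sqrt (s / real m) \<and>
              L2_norm \<nu> (\<lambda>u. f u - f' u)
                \<le> c2 * (best_approx_error \<Lambda> \<omega> s x / sqrt s) + d2 * \<eta> * sqrt (1 / real m))))"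
proof (intro exI conjI allI impI)
  \<comment> \<open>The witnesses \<open>10 ^ 11\<close>, 4, 64, 1 and 16 enter by unification with
    the assumption on \<open>m\<close> and the goal shown below; their positivity is left to the
    closing \<open>simp_all\<close>.\<close>
  fix d :: nat and D :: "(nat \<Rightarrow> real) set" and \<nu> :: "(nat \<Rightarrow> real) measure" and \<Lambda> :: "nat set"
    and \<psi> :: "nat \<Rightarrow> (nat \<Rightarrow> real) \<Rightarrow> complex" and \<omega> :: "nat \<Rightarrow> real" and s \<gamma> :: real and m :: nat
  assume "finite \<Lambda>" "\<Lambda> \<noteq> {}" "orthonormal_system D \<nu> \<Lambda> \<psi>"
    and \<omega>: "\<forall>j\<in>\<Lambda>. \<omega> j \<ge> 1 \<and> ereal (\<omega> j) \<ge> sup_norm D (\<psi> j)"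
    and s: "s \<ge> 2 * (MAX j\<in>\<Lambda>. \<bar>\<omega> j\<bar>\<^sup>2)" and \<gamma>: "0 < \<gamma>" "\<gamma> < 1"
    and m: "real m \<ge> 10 ^ 11 * s * max ((ln s) ^ 3 * ln (real (card \<Lambda>))) (ln (1 / \<gamma>))"
  then interpret weighted_orthonormal_system D \<nu> \<Lambda> \<psi> \<omega>
    by unfold_locales auto
  note bound = restricted_lower_bound[OF s \<gamma> m]
  obtain E where E: "E \<in> sets (\<Pi>\<^sub>M l\<in>{..<m}. \<nu>)" "1 - \<gamma> < measure (\<Pi>\<^sub>M l\<in>{..<m}. \<nu>) E"
    and lower: "\<And>t v. t \<in> E \<Longrightarrow> weighted_l1 \<Lambda> \<omega> v \<le> 4 * sqrt s * L2_set (\<lambda>j. cmod (v j)) \<Lambda> \<Longrightarrow>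
       real m / 64 * (\<Sum>j\<in>\<Lambda>. (cmod (v j))\<^sup>2) \<le> (\<Sum>l<m. (cmod (expansion \<Lambda> \<psi> v (t l)))\<^sup>2)"
    using bound(1) by blast
  show "\<exists>E \<in> sets (\<Pi>\<^sub>M l\<in>{..<m}. \<nu>).
         measure (\<Pi>\<^sub>M l\<in>{..<m}. \<nu>) E > 1 - \<gamma> \<and>
         (\<forall>t\<in>E. \<forall>(x :: nat \<Rightarrow> complex) (f :: (nat \<Rightarrow> real) \<Rightarrow> complex)
             (\<xi> :: nat \<Rightarrow> complex) (y :: nat \<Rightarrow> complex) (\<eta> :: real)
             (x' :: nat \<Rightarrow> complex) (f' :: (nat \<Rightarrow> real) \<Rightarrow> complex).
            f = expansion \<Lambda> \<psi> x \<longrightarrow>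
            (\<forall>l<m. y l = f (t l) + \<xi> l) \<longrightarrow>
            l2_norm m \<xi> \<le> \<eta> \<longrightarrow>
            is_weighted_l1_solution m \<Lambda> \<omega> (sampling_matrix \<psi> t) y \<eta> x' \<longrightarrow>
            f' = expansion \<Lambda> \<psi> x' \<longrightarrow>
              sup_norm D (\<lambda>u. f u - f' u) \<le> ereal (weighted_l1 \<Lambda> \<omega> (\<lambda>j. x j - x' j)) \<and>
              weighted_l1 \<Lambda> \<omega> (\<lambda>j. x j - x' j)
                \<le> 4 * best_approx_error \<Lambda> \<omega> s x + 64 * \<eta> * sqrt (s / real m) \<and>
              L2_norm \<nu> (\<lambda>u. f u - f' u)
                \<le> 1 * (best_approx_error \<Lambda> \<omega> s x / sqrt s) + 16 * \<eta> * sqrt (1 / real m))"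
  proof (intro bexI[OF _ E(1)] conjI[OF E(2)] ballI allI impI)
    fix t x f \<xi> y \<eta> x' f'
    assume t: "t \<in> E" and f: "f = expansion \<Lambda> \<psi> x" "f' = expansion \<Lambda> \<psi> x'"
      and y: "\<forall>l<m. y l = f (t l) + \<xi> l" and \<eta>: "l2_norm m \<xi> \<le> \<eta>"
      and sol: "is_weighted_l1_solution m \<Lambda> \<omega> (sampling_matrix \<psi> t) y \<eta> x'"
    have diff: "(\<lambda>u. f u - f' u) = expansion \<Lambda> \<psi> (\<lambda>j. x j - x' j)"
      unfolding f by (simp add: expansion_def left_diff_distrib sum_subtractf)
    have s0: "0 < s" using bound(2) by simp
    have y': "y l = expansion \<Lambda> \<psi> x (t l) + \<xi> l" if "l < m" for l using y f that by simp
    have recovery: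
      "weighted_l1 \<Lambda> \<omega> (\<lambda>j. x j - x' j) \<le> 4 * best_approx_error \<Lambda> \<omega> s x + 64 * \<eta> * sqrt (s / real m)"
      "L2_set (\<lambda>j. cmod (x j - x' j)) \<Lambda> \<le> best_approx_error \<Lambda> \<omega> s x / sqrt s + 16 * \<eta> * sqrt (1 / real m)"
      by (rule weighted_l1_recovery[OF s0 bound(3) \<eta> _ _ sol], rule lower[OF t], assumption, rule y', assumption)+
    show "sup_norm D (\<lambda>u. f u - f' u) \<le> ereal (weighted_l1 \<Lambda> \<omega> (\<lambda>j. x j - x' j)) \<and>
        weighted_l1 \<Lambda> \<omega> (\<lambda>j. x j - x' j)
          \<le> 4 * best_approx_error \<Lambda> \<omega> s x + 64 * \<eta> * sqrt (s / real m) \<and>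
        L2_norm \<nu> (\<lambda>u. f u - f' u)
          \<le> 1 * (best_approx_error \<Lambda> \<omega> s x / sqrt s) + 16 * \<eta> * sqrt (1 / real m)"
      unfolding diff L2_norm_expansion mult_1_left by (intro conjI sup_norm_expansion_le recovery)
  qed
qed simp_all

end
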